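(* Assume the Continuum Hypothesis. Let $\mathbb G,\mathbb H\subseteq\mathbb E$ be such that $\mathbb H$ is dense, shrinkable and $\mathbb G$-large. Then there is a zero-dimensional Hausdorff topology $\tau$ on the set $X=C\cup\omega_1$ (disjoint union) such that (i) $X$ has countable tightness, and $\omega_1$ is left-separated in its natural order; (ii) $C$ is a dense open subspace of $X$ and $\tau\restriction C$ is the natural topology $\varepsilon$ of $C$; (iii) $\overline{R(g)}\cap\omega_1=\emptyset$ for each $g\in\mathbb G$; (iv) $\overline{R(h)}\cap\omega_1\ne\emptyset$ for each $h\in\mathbb H$, where closures are taken in $(X,\tau)$.
   Context: For $n\in\omega$ let $C_n=\{n\}\times 2^\omega$ and $C=\bigcup_n C_n$; $\varepsilon$ denotes the natural topology on $C$ (product of discrete $\omega$ and the Cantor space). $\mathbb E$ is the set of functions $e$ with $\mathrm{dom}(e)$ an infinite subset of $\omega$ and $\emptyset\ne e(n)\subseteq C_n$ for $n\in\mathrm{dom}(e)$; $\mathbb O=\{o\in\mathbb E: o(n) \text{ is clopen in } C_n \text{ for all } n\in\mathrm{dom}(o)\}$. For $e\in\mathbb E$, $R(e)=\bigcup_{n\in\mathrm{dom}(e)}e(n)$. For $f,g\in\mathbb E$: $f\sqsubset g$ iff $\mathrm{dom}(f)\subseteq\mathrm{dom}(g)$ and $f(n)\subseteq g(n)$ for all $n\in\mathrm{dom}(f)$; $f\sqsubseteq^* g$ iff $\mathrm{dom}(f)\setminus\mathrm{dom}(g)$ is finite and $\{n\in\mathrm{dom}(f): f(n)\not\subseteq g(n)\}$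 is finite; $f\perp g$ iff $\{n\in\mathrm{dom}(f)\cap\mathrm{dom}(g): f(n)\cap g(n)\ne\emptyset\}$ is finite. For $h,o\in\mathbb E$, $h\dot- o$ is the function with domain $\{n\in\mathrm{dom}(h):h(n)\not\subseteq o(n)\}$ (where $h(n)\not\subseteq o(n)$ holds automatically if $n\notin\mathrm{dom}(o)$) and $(h\dot- o)(n)=h(n)\setminus o(n)$ if $n\in\mathrm{dom}(o)$, $(h\dot- o)(n)=h(n)$ otherwise. For $\mathbb G,\mathbb H\subseteq\mathbb E$: $\mathbb H$ is dense iff for each $o\in\mathbb O$ there is $h\in\mathbb H$ with $h\sqsubset o$; $\mathbb H$ is shrinkable iff for each $h\in\mathbb H$ and each countable $\mathcal O\subseteq\mathbb O$ there is $h'\in\mathbb H$ with $h'\sqsubset h$ and, for every $o\in\mathcal O$, $h'\sqsubseteq^* o$ or $h'\perp o$; $\mathbb H$ is $\mathbb G$-large iff for each $g\in\mathbb G$ and each countable $\mathcal H\subseteq\mathbb H$ there is $o\in\mathbb O$ with $g\sqsubset o$ and $h\dot- o\in\mathbb H$ for each $h\in\mathcal H$. A subset $Y$ well-ordered by an order is left-separated in that order if every initial segment of $Y$ is closed in $Y$. *)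

theory Defs
  imports "HOL-Analysis.Analysis"
begin

text \<open>Cantor space 2^omega is represented by the type nat \<Rightarrow> bool; the space
  C = omega \<times> 2^omega by nat \<times> (nat \<Rightarrow> bool).\<close>

type_synonym cpt = "nat \<times> (nat \<Rightarrow> bool)"

definition Cn :: "nat \<Rightarrow> cpt set" where
  "Cn n = {n} \<times> UNIV"

definition eps_top :: "cpt topology" where
  "eps_top = prod_topology (discrete_topology UNIV)
                (product_topology (\<lambda>_. discrete_topology (UNIV :: bool set)) UNIV)"

type_synonym efun = "nat \<rightharpoonup> cpt set"

definition Efam :: "efun set" where
  "Efam = {e. infinite (dom e) \<and> (\<forall>n\<in>dom e. the (e n) \<noteq> {} \<and> the (e n) \<subseteq> Cn n)}"

definition Ofam :: "efun set" where
  "Ofam = {u \<in> Efam. \<forall>n\<in>dom u.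
           openin (subtopology eps_top (Cn n)) (the (u n)) \<and>
           closedin (subtopology eps_top (Cn n)) (the (u n))}"

definition Rng :: "efun \<Rightarrow> cpt set" where
  "Rng e = (\<Union>n\<in>dom e. the (e n))"

definition sqsub :: "efun \<Rightarrow> efun \<Rightarrow> bool" where
  "sqsub f g \<longleftrightarrow> dom f \<subseteq> dom g \<and> (\<forall>n\<in>dom f. the (f n) \<subseteq> the (g n))"

definition sqsub_star :: "efun \<Rightarrow> efun \<Rightarrow> bool" where
  "sqsub_star f g \<longleftrightarrow> finite (dom f - dom g) \<and>
     finite {n \<in> dom f. n \<notin> dom g \<or> \<not> the (f n) \<subseteq> the (g n)}"

definition eperp :: "efun \<Rightarrow> efun \<Rightarrow> bool" where
  "eperp f g \<longleftrightarrow> finite {n \<in> dom f \<inter> dom g. the (f n) \<inter> the (g n) \<noteq> {}}"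

definition eminus :: "efun \<Rightarrow> efun \<Rightarrow> efun" where
  "eminus h u = (\<lambda>n. if n \<in> dom h \<and> (n \<notin> dom u \<or> \<not> the (h n) \<subseteq> the (u n))
                     then Some (if n \<in> dom u then the (h n) - the (u n) else the (h n))
                     else None)"

definition dense_fam :: "efun set \<Rightarrow> bool" where
  "dense_fam H \<longleftrightarrow> (\<forall>u\<in>Ofam. \<exists>h\<in>H. sqsub h u)"

definition shrinkable :: "efun set \<Rightarrow> bool" where
  "shrinkable H \<longleftrightarrow> (\<forall>h\<in>H. \<forall>\<O>. \<O> \<subseteq> Ofam \<and> countable \<O> \<longrightarrow>
      (\<exists>h'\<in>H. sqsub h' h \<and> (\<forall>u\<in>\<O>. sqsub_star h' u \<or> eperp h' u)))"

definition large :: "efun set \<Rightarrow> efun set \<Rightarrow> bool" where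
  "large G H \<longleftrightarrow> (\<forall>g\<in>G. \<forall>\<H>. \<H> \<subseteq> H \<and> countable \<H> \<longrightarrow>
      (\<exists>u\<in>Ofam. sqsub g u \<and> (\<forall>h\<in>\<H>. eminus h u \<in> H)))"

definition countable_tightness :: "'a topology \<Rightarrow> bool" where
  "countable_tightness T \<longleftrightarrow> (\<forall>A x. A \<subseteq> topspace T \<and> x \<in> T closure_of A \<longrightarrow>
      (\<exists>B \<subseteq> A. countable B \<and> x \<in> T closure_of B))"

definition omega1_type :: "'w::wellorder itself \<Rightarrow> bool" where
  "omega1_type _ \<longleftrightarrow> uncountable (UNIV :: 'w set) \<and> (\<forall>a::'w. countable {b. b < a})"

end

theory Submission
  imports Defs
begin

text \<open>Identify a function e in E with its range, a subset of C meeting infinitely many levels;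
  then almost inclusion means inclusion outside finitely many levels.  By recursion on a < omega_1
  choose a clopen set T(a) and a set k(a) in H, and let a point b belong to the clopen set
  generated by T(a) iff a \<le> b and k(b) is almost contained in T(a).  Thus b is determined by
  the limit of k(b), decided by shrinkability for all earlier clopen sets, and the
  a-th clopen set contains a but no earlier point.  This property alone gives left-separation,
  and it gives countable tightness because the topology on an initial segment is never
  changed later, so that a closing-off argument reflects closures to countable initial
  segments.  Largeness allows T(a) to cover a given g in G while every old point stays in the closure
  of the sets from H assigned to it: for each of the countably many basic neighbourhoods one
  member of H inside it is remembered.  A closed subset of C is
  a countable object, so under CH there are only omega_1 closures of ranges to be handled.\<close>

section \<open>Clopen sets in the sum of Cantor spaces\<close>

lemma eps_top_eq_euclidean: "eps_top = euclidean"
proof -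
  have d: "discrete_topology UNIV = (euclidean :: 'a::discrete_topology topology)"
    by (simp add: topology_eq open_discrete)
  show ?thesis
    unfolding eps_top_def d euclidean_product_topology prod_topology_euclidean ..
qed

definition clop :: "'a::topological_space set \<Rightarrow> bool" where
  "clop T \<longleftrightarrow> open T \<and> closed T"

lemma clop_Compl: "clop T \<Longrightarrow> clop (- T)"
  by (auto simp: clop_def)

lemma clop_Int: "clop S \<Longrightarrow> clop T \<Longrightarrow> clop (S \<inter> T)"
  by (auto simp: clop_def)

lemma clop_Un: "clop S \<Longrightarrow> clop T \<Longrightarrow> clop (S \<union> T)"
  by (auto simp: clop_def)

lemma clop_INT: "finite F \<Longrightarrow> (\<And>i. i \<in> F \<Longrightarrow> clop (T i)) \<Longrightarrow> clop (\<Inter>i\<in>F. T i)"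
  by (auto simp: clop_def)

lemma clop_fst_vimage: "clop (fst -` D :: cpt set)"
proof -
  have "open (fst -` E :: cpt set)" for E
    by (intro open_vimage_fst open_discrete)
  from this[of D] this[of "- D"] show ?thesis
    by (simp add: clop_def closed_def vimage_Compl)
qed

text \<open>The levels form a clopen partition, so a set and its complement may be tested for
  openness level by level. Thus infinitely many clopen conditions cut out a clopen set once each
  level sees only finitely many of them.\<close>

lemma clop_slices:
  fixes T :: "cpt set"
  assumes "\<And>n. clop (T \<inter> fst -` {n})"
  shows "clop T"
proof -
  have T: "T = (\<Union>n. T \<inter> fst -` {n})" and T': "- T = (\<Union>n. - (T \<inter> fst -` {n}) \<inter> fst -` {n})"
    by auto
  have "open (- (T \<inter> fst -` {n}) \<inter> fst -` {n})" for n
    using clop_Int[OF clop_Compl[OF assms] clop_fst_vimage] by (auto simp: clop_def)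
  then have "open (- T)" by (subst T') (rule open_UN, blast)
  moreover have "open T" using assms by (subst T) (rule open_UN, simp add: clop_def)
  ultimately show ?thesis by (simp add: clop_def closed_def)
qed

section \<open>A countable clopen base of C, separability and closed sets\<close>

definition cylinder :: "nat \<times> bool list \<Rightarrow> cpt set" where
  "cylinder p = {c. fst c = fst p \<and> (\<forall>i<length (snd p). snd c i = snd p ! i)}"

lemma clop_cylinder: "clop (cylinder p)"
proof -
  have 1: "clop {c :: cpt. snd c i = b}" for i b
  proof -
    have "clop {x :: nat \<Rightarrow> bool. x i = b}" (is "clop ?S")
    proof -
      have c: "continuous_on UNIV (\<lambda>x :: nat \<Rightarrow> bool. x i)"
        by (rule continuous_on_product_coordinates)
      have o: "open ((\<lambda>x :: nat \<Rightarrow> bool. x i) -` E)" for E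
        by (rule open_vimage[OF open_discrete c])
      have "?S = (\<lambda>x. x i) -` {b}" "- ?S = (\<lambda>x. x i) -` (- {b})" by auto
      then show ?thesis unfolding clop_def closed_def using o by simp
    qed
    moreover have "{c :: cpt. snd c i = b} = snd -` {x. x i = b}" by auto
    ultimately show ?thesis unfolding clop_def by (metis open_vimage_snd closed_vimage_snd)
  qed
  have "cylinder p = fst -` {fst p} \<inter> (\<Inter>i\<in>{..<length (snd p)}. {c. snd c i = snd p ! i})"
    by (auto simp: cylinder_def)
  also have "clop \<dots>"
    by (intro clop_Int clop_fst_vimage clop_INT 1) auto
  finally show ?thesis .
qed

text \<open>A basic open set of the product restricts finitely many coordinates, all below some
  \<open>m\<close>, so the level and the first \<open>m\<close> bits of \<open>c\<close> suffice.
  The index type of \<open>cylinder\<close> is countable, hence so is this base.\<close>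

lemma cylinder_basis:
  assumes "open S" "c \<in> S"
  obtains p where "c \<in> cylinder p" "cylinder p \<subseteq> S"
proof -
  obtain A B where AB: "open A" "open B" "c \<in> A \<times> B" "A \<times> B \<subseteq> S"
    using open_prod_elim[OF assms] by blast
  have "openin (product_topology (\<lambda>_::nat. euclidean :: bool topology) UNIV) B"
    using AB(2) by (simp add: euclidean_product_topology)
  from product_topology_open_contains_basis[OF this, of "snd c"] AB(3)
  obtain X where X: "snd c \<in> Pi\<^sub>E UNIV X" "finite {i. X i \<noteq> UNIV}" "Pi\<^sub>E UNIV X \<subseteq> B"
    by auto
  obtain m where m: "\<And>i. X i \<noteq> UNIV \<Longrightarrow> i < m"
    using X(2) unfolding finite_nat_set_iff_bounded by auto
  define p where "p = (fst c, map (snd c) [0..<m])"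
  have "c \<in> cylinder p" by (simp add: cylinder_def p_def)
  moreover have "d \<in> S" if d: "d \<in> cylinder p" for d
  proof -
    have "snd d i \<in> X i" for i
      using m[of i] X(1) d by (cases "i < m") (auto simp: cylinder_def p_def PiE_iff)
    then have "snd d \<in> B" using X(3) by (auto simp: PiE_iff)
    moreover have "fst d = fst c" using d by (simp add: cylinder_def p_def)
    ultimately show ?thesis using AB by (metis mem_Times_iff subsetD)
  qed
  ultimately show ?thesis using that by blast
qed

lemma closed_singleton_cpt: "closed {c :: cpt}"
proof -
  define p where "p k = (fst c, map (snd c) [0..<k])" for k
  have "d = c" if d: "\<forall>k. d \<in> cylinder (p k)" for d
  proof (rule prod_eqI)
    show "fst d = fst c" using d by (simp add: cylinder_def p_def)
    show "snd d = snd c"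
    proof
      fix i show "snd d i = snd c i" using d[rule_format, of "Suc i"] by (simp add: cylinder_def p_def nth_append)
    qed
  qed
  moreover have "c \<in> cylinder (p k)" for k by (simp add: cylinder_def p_def)
  ultimately have "{c} = (\<Inter>k. cylinder (p k))" by blast
  moreover have "closed (\<Inter>k. cylinder (p k))"
    using clop_cylinder by (intro closed_INT) (simp add: clop_def)
  ultimately show ?thesis by simp
qed

text \<open>One point is chosen from each nonempty \<open>A \<inter> cylinder p\<close>.\<close>

lemma countable_dense_subset_cpt:
  fixes A :: "cpt set"
  obtains D where "D \<subseteq> A" "countable D"
    "\<And>S c. open S \<Longrightarrow> c \<in> A \<Longrightarrow> c \<in> S \<Longrightarrow> \<exists>d\<in>D. d \<in> S"
proof -
  define f where "f p = (SOME c. c \<in> A \<inter> cylinder p)" for p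
  define D where "D = f ` {p. A \<inter> cylinder p \<noteq> {}}"
  have f: "f p \<in> A \<inter> cylinder p" if "A \<inter> cylinder p \<noteq> {}" for p
    unfolding f_def using that by (metis ex_in_conv someI_ex)
  show ?thesis
  proof
    show "D \<subseteq> A" unfolding D_def using f by blast
    show "countable D" unfolding D_def by simp
    show "\<exists>d\<in>D. d \<in> S" if S: "open S" "c \<in> A" "c \<in> S" for S c
    proof -
      obtain p where p: "c \<in> cylinder p" "cylinder p \<subseteq> S" using cylinder_basis[OF S(1,3)] .
      then have "A \<inter> cylinder p \<noteq> {}" using S(2) by blast
      then have "f p \<in> D" "f p \<in> S" using f[of p] p(2) unfolding D_def by blast+
      then show ?thesis by blast
    qed
  qed
qed

text \<open>A closed set is determined by the indices of the base members disjoint from it.\<close>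

lemma surj_closed_sets:
  obtains F :: "(nat \<Rightarrow> bool) \<Rightarrow> cpt set" where "range F = Collect closed"
proof -
  define B :: "nat \<Rightarrow> cpt set" where "B n = cylinder (from_nat n)" for n
  define F where "F x = - \<Union>(B ` {n. x n})" for x
  have "open (B n)" for n
    using clop_cylinder[of "from_nat n"] by (simp add: B_def clop_def)
  then have "F x \<in> Collect closed" for x
    unfolding F_def by (simp add: closed_Compl open_UN del: Compl_UN)
  moreover have "S \<in> range F" if "closed S" for S
  proof
    show "S = F (\<lambda>n. B n \<subseteq> - S)"
    proof -
      have "\<exists>n. c \<in> B n \<and> B n \<subseteq> - S" if "c \<notin> S" for c
      proof -
        have "open (- S)" "c \<in> - S" using \<open>closed S\<close> that by auto
        then obtain p where "c \<in> cylinder p" "cylinder p \<subseteq> - S" by (rule cylinder_basis)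
        then show ?thesis unfolding B_def by (metis from_nat_to_nat)
      qed
      then show ?thesis unfolding F_def by blast
    qed
  qed simp
  ultimately show ?thesis using that by blast
qed

text \<open>The even coordinates code the value, the odd ones make every fibre uncountable.\<close>
lemma unbounded_enumeration_closed_sets:
  assumes w1: "omega1_type TYPE('w::wellorder)"
    and CH: "\<exists>f :: 'w \<Rightarrow> (nat \<Rightarrow> bool). bij f"
  obtains c :: "'w::wellorder \<Rightarrow> cpt set" where "\<And>S a. closed S \<Longrightarrow> \<exists>b>a. c b = S"
proof -
  obtain f :: "'w \<Rightarrow> (nat \<Rightarrow> bool)" where f: "bij f" using CH by blast
  obtain F :: "(nat \<Rightarrow> bool) \<Rightarrow> cpt set" where F: "range F = Collect closed"
    using surj_closed_sets .
  define c where "c b = F (\<lambda>n. f b (2 * n))" for b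
  have "\<exists>b>a. c b = S" if S: "closed S" for S a
  proof (rule ccontr)
    assume neg: "\<not> ?thesis"
    obtain x where x: "F x = S" using F S by (metis imageE mem_Collect_eq)
    define g where "g y = (\<lambda>n. if even n then x (n div 2) else y (n div 2))" for y :: "nat \<Rightarrow> bool"
    \<comment> \<open>\<open>k\<close> maps every index into the fibre of \<open>c\<close> over
      \<open>S\<close>. If that fibre were bounded by \<open>a\<close>, injectivity of
      \<open>k\<close> would make \<open>'w\<close> countable.\<close>
    define k where "k d = inv f (g (f d))" for d
    have "f d = f e" if "g (f d) = g (f e)" for d e
    proof
      fix n show "f d n = f e n" using fun_cong[OF that, of "2 * n + 1"] by (simp add: g_def)
    qed
    then have "inj k"
      using f unfolding k_def
      by (intro injI) (metis bij_def surj_f_inv_f injD)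
    moreover have "c (k d) = S" for d
      using f x by (simp add: c_def k_def surj_f_inv_f bij_is_surj g_def)
    then have "range k \<subseteq> {b. b \<le> a}" using neg by (auto simp: not_less)
    moreover have "countable {b. b \<le> a}"
    proof -
      have "{b. b \<le> a} = insert a {b. b < a}" by auto
      then show ?thesis using w1 by (simp add: omega1_type_def)
    qed
    ultimately have "countable (UNIV :: 'w set)"
      using countable_subset countable_image_inj_on by blast
    then show False using w1 by (simp add: omega1_type_def)
  qed
  then show ?thesis using that by blast
qed

section \<open>One step of the construction\<close>

definition almost_sub :: "cpt set \<Rightarrow> cpt set \<Rightarrow> bool" where
  "almost_sub A T \<longleftrightarrow> finite (fst ` (A - T))"

lemma almost_sub_mono: "almost_sub A T \<Longrightarrow> B \<subseteq> A \<Longrightarrow> T \<subseteq> S \<Longrightarrow> almost_sub B S"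
  unfolding almost_sub_def by (erule rev_finite_subset) blast

lemma almost_sub_Int: "almost_sub A S \<Longrightarrow> almost_sub A T \<Longrightarrow> almost_sub A (S \<inter> T)"
  by (simp add: almost_sub_def Diff_Int image_Un)

lemma almost_sub_INT:
  "finite F \<Longrightarrow> (\<And>i. i \<in> F \<Longrightarrow> almost_sub A (T i)) \<Longrightarrow> almost_sub A (\<Inter>i\<in>F. T i)"
  by (induction F rule: finite_induct) (auto intro!: almost_sub_Int simp: almost_sub_def[of _ UNIV])

lemma almost_sub_meets:
  assumes "almost_sub A T" "infinite (fst ` A)" "finite M"
  shows "\<exists>c\<in>A \<inter> T. fst c \<notin> M"
proof (rule ccontr)
  assume "\<not> ?thesis"
  then have "fst ` A \<subseteq> M \<union> fst ` (A - T)" by blast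
  then show False using assms finite_subset by (auto simp: almost_sub_def)
qed

definition side :: "bool \<Rightarrow> 'a set \<Rightarrow> 'a set" where
  "side b T = (if b then T else - T)"

lemma clop_side: "clop T \<Longrightarrow> clop (side b T)"
  by (simp add: side_def clop_Compl)

text \<open>The trace on C of a basic neighbourhood of a point whose membership in the generators
  \<open>t\<close> is recorded by \<open>m\<close>.\<close>

definition cell :: "('i \<Rightarrow> bool) \<Rightarrow> ('i \<Rightarrow> cpt set) \<Rightarrow> 'i set \<Rightarrow> cpt set" where
  "cell m t F = (\<Inter>i\<in>F. side (m i) (t i))"

lemma cell_cong:
  "(\<And>i. i \<in> F \<Longrightarrow> m i = m' i) \<Longrightarrow> (\<And>i. i \<in> F \<Longrightarrow> t i = t' i) \<Longrightarrow> cell m t F = cell m' t' F"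
  by (simp add: cell_def)

lemma clop_cell: "finite F \<Longrightarrow> (\<And>i. i \<in> F \<Longrightarrow> clop (t i)) \<Longrightarrow> clop (cell m t F)"
  unfolding cell_def by (intro clop_INT clop_side)

text \<open>The hypotheses expressed for ranges: a member of \<open>Ofam\<close> becomes a clopen
  set meeting infinitely many levels, and \<open>eperp\<close> becomes almost inclusion in the
  complement.\<close>

locale large_family =
  fixes \<H> \<G> :: "cpt set set"
  assumes infinite_fst: "A \<in> \<H> \<Longrightarrow> infinite (fst ` A)"
    and dense: "clop T \<Longrightarrow> infinite (fst ` T) \<Longrightarrow> \<exists>A\<in>\<H>. A \<subseteq> T"
    and shrink: "A \<in> \<H> \<Longrightarrow> countable \<T> \<Longrightarrow> (\<And>T. T \<in> \<T> \<Longrightarrow> clop T) \<Longrightarrow>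
      \<exists>B\<in>\<H>. B \<subseteq> A \<and> (\<forall>T\<in>\<T>. almost_sub B T \<or> almost_sub B (- T))"
    and large: "g \<in> \<G> \<Longrightarrow> \<A> \<subseteq> \<H> \<Longrightarrow> countable \<A> \<Longrightarrow>
      \<exists>T. clop T \<and> g \<subseteq> T \<and> (\<forall>A\<in>\<A>. A - T \<in> \<H>)"
begin

text \<open>Two cases: if the shrunken h converges to an old point p, then p together with h becomes a new
  convergence to be preserved, and the new point is put into the room left by the old ones;
  otherwise h itself converges to the new point.  In both cases the new set k stays
  away from some neighbourhood of each old point, and diagonalising over the countably
  many old points gives a clopen set T0 around k that does the same.\<close>
lemma extension_step:
  fixes t :: "'i \<Rightarrow> cpt set" and m :: "'p \<Rightarrow> 'i \<Rightarrow> bool"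
  assumes cI: "countable I" and cP: "countable P" and cQ: "countable Q"
    and Q: "Q \<subseteq> P \<times> \<H>"
    and t: "\<forall>i\<in>I. clop (t i)"
    and conv: "\<forall>p A F. (p, A) \<in> Q \<longrightarrow> finite F \<longrightarrow> F \<subseteq> I \<longrightarrow>
      (\<exists>B\<in>\<H>. B \<subseteq> A \<and> almost_sub B (cell (m p) t F))"
    and room: "clop w" "infinite (fst ` w)"
      "\<forall>p\<in>P. \<exists>i\<in>I. almost_sub w (- side (m p i) (t i))"
    and h: "h \<in> \<H>"
  shows "\<exists>k k' T Q'. k \<in> \<H> \<and> k' \<in> \<H> \<and> clop T \<and> k' \<subseteq> h \<and> almost_sub k T \<and>
    (\<forall>i\<in>I. almost_sub k (t i) \<or> almost_sub k (- t i)) \<and> (g \<in> \<G> \<longrightarrow> g \<subseteq> T) \<and>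
    (Q' = Q \<and> k' = k \<or> (\<exists>p\<in>P. Q' = insert (p, k') Q)) \<and>
    (\<forall>p A F. (p, A) \<in> Q' \<longrightarrow> finite F \<longrightarrow> F \<subseteq> I \<longrightarrow>
      (\<exists>B\<in>\<H>. B \<subseteq> A \<and> almost_sub B (cell (m p) t F - T)))"
proof -
  note t = t[rule_format] and conv = conv[rule_format] and room = room(1,2) room(3)[rule_format]
  have decide: "\<exists>B\<in>\<H>. B \<subseteq> A \<and> (\<forall>i\<in>I. almost_sub B (t i) \<or> almost_sub B (- t i))"
    if "A \<in> \<H>" for A
    using shrink[OF that, of "t ` I"] cI t by auto
  obtain k k' Q' where k: "k \<in> \<H>" "k' \<in> \<H>" "k' \<subseteq> h"
      "\<And>i. i \<in> I \<Longrightarrow> almost_sub k (t i) \<or> almost_sub k (- t i)"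
    and Q': "Q' = Q \<and> k' = k \<or> (\<exists>p\<in>P. Q' = insert (p, k') Q)"
    and conv': "\<And>p A F. (p, A) \<in> Q' \<Longrightarrow> finite F \<Longrightarrow> F \<subseteq> I \<Longrightarrow>
      \<exists>B\<in>\<H>. B \<subseteq> A \<and> almost_sub B (cell (m p) t F)"
    and away: "\<And>p. p \<in> P \<Longrightarrow> \<exists>i\<in>I. almost_sub k (- side (m p i) (t i))"
  proof -
    obtain h' where h': "h' \<in> \<H>" "h' \<subseteq> h"
      "\<forall>i\<in>I. almost_sub h' (t i) \<or> almost_sub h' (- t i)"
      using decide[OF h] by blast
    show ?thesis
    proof (cases "\<exists>p\<in>P. \<forall>i\<in>I. almost_sub h' (side (m p i) (t i))")
      case True
      then obtain p where p: "p \<in> P" "\<And>i. i \<in> I \<Longrightarrow> almost_sub h' (side (m p i) (t i))" by blast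
      obtain k0 where k0: "k0 \<in> \<H>" "k0 \<subseteq> w" using dense room by blast
      obtain k where k: "k \<in> \<H>" "k \<subseteq> k0"
        "\<forall>i\<in>I. almost_sub k (t i) \<or> almost_sub k (- t i)"
        using decide[OF k0(1)] by blast
      have cellp: "almost_sub h' (cell (m p) t F)" if "finite F" "F \<subseteq> I" for F
        unfolding cell_def using that p(2) by (intro almost_sub_INT) auto
      have conv2: "\<exists>B\<in>\<H>. B \<subseteq> A \<and> almost_sub B (cell (m q) t F)"
        if "(q, A) \<in> insert (p, h') Q" "finite F" "F \<subseteq> I" for q A F
      proof (cases "(q, A) = (p, h')")
        case True
        then show ?thesis using cellp[OF that(2,3)] h'(1) by auto
      next
        case False
        then have "(q, A) \<in> Q" using that(1) by auto
        then show ?thesis by (rule conv[OF _ that(2,3)])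
      qed
      have away2: "\<exists>i\<in>I. almost_sub k (- side (m q i) (t i))" if "q \<in> P" for q
        using room(3)[OF that] k k0 by (meson almost_sub_mono order.trans order_refl)
      show ?thesis
      proof (rule that[OF k(1) h'(1) h'(2) _ _ conv2 away2])
        show "insert (p, h') Q = Q \<and> h' = k \<or> (\<exists>q\<in>P. insert (p, h') Q = insert (q, h') Q)"
          using p(1) by blast
      qed (use k(3) in blast)
    next
      case False
      \<comment> \<open>Every generator is decided by \<open>h'\<close>, so not converging to
        \<open>q\<close> means lying almost entirely on the wrong side of some generator.\<close>
      have away2: "\<exists>i\<in>I. almost_sub h' (- side (m q i) (t i))" if "q \<in> P" for q
      proof -
        obtain i where i: "i \<in> I" "\<not> almost_sub h' (side (m q i) (t i))"
          using False \<open>q \<in> P\<close> by blast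
        then have "almost_sub h' (- side (m q i) (t i))"
          using h'(3) by (auto simp: side_def split: if_splits)
        then show ?thesis using i(1) by blast
      qed
      show ?thesis
        by (rule that[OF h'(1) h'(1) h'(2) _ _ conv away2]) (use h'(3) in blast)+
    qed
  qed
  define e where "e p = (SOME i. i \<in> I \<and> almost_sub k (- side (m p i) (t i)))" for p
  \<comment> \<open>\<open>W p\<close> gives a neighbourhood of the old point \<open>p\<close> that
    almost misses \<open>k\<close>.\<close>
  define W where "W p = side (m p (e p)) (t (e p))" for p
  have e: "e p \<in> I" "almost_sub k (- W p)" if "p \<in> P" for p
    unfolding W_def e_def using someI_ex[OF away[OF that, unfolded Bex_def]] by blast+
  have clopW: "clop (W p)" if "p \<in> P" for p
    unfolding W_def using that by (intro clop_side t e)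
  \<comment> \<open>At level \<open>n\<close> only the finitely many \<open>W p\<close> with
    \<open>p\<close> numbered at most \<open>n\<close> are removed, which keeps the slice clopen,
    and only if \<open>W p\<close> misses \<open>k\<close> at that level, which keeps
    \<open>k\<close> inside. Still, each \<open>W p\<close> is removed at all but finitely many
    levels.\<close>
  define T0 where "T0 = {c. \<forall>p\<in>P. to_nat_on P p \<le> fst c \<longrightarrow> fst c \<notin> fst ` (k \<inter> W p) \<longrightarrow> c \<notin> W p}"
  have "clop T0"
  proof (rule clop_slices)
    fix n
    define J where "J = {p\<in>P. to_nat_on P p \<le> n \<and> n \<notin> fst ` (k \<inter> W p)}"
    have "inj_on (to_nat_on P) J"
      using inj_on_to_nat_on[OF cP] by (rule inj_on_subset) (auto simp: J_def)
    moreover have "to_nat_on P ` J \<subseteq> {..n}" by (auto simp: J_def)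
    ultimately have "finite J" using finite_imageD finite_subset finite_atMost by blast
    moreover have "T0 \<inter> fst -` {n} = (\<Inter>p\<in>J. - W p) \<inter> fst -` {n}"
      unfolding T0_def J_def by auto
    ultimately show "clop (T0 \<inter> fst -` {n})"
      using clopW by (auto intro!: clop_Int clop_fst_vimage clop_INT clop_Compl simp: J_def)
  qed
  have "k \<subseteq> T0" by (auto simp: T0_def)
  have T0W: "almost_sub T0 (- W p)" if "p \<in> P" for p
  proof -
    have "fst ` (T0 - - W p) \<subseteq> {..to_nat_on P p} \<union> fst ` (k - - W p)"
      using that unfolding T0_def by (auto simp: not_le) 
    then show ?thesis
      using e(2)[OF that] finite_subset unfolding almost_sub_def by blast
  qed
  have Q'P: "Q' \<subseteq> P \<times> \<H>" "countable Q'" using Q' Q k cQ by auto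
  define R where "R = Q' \<times> {F. finite F \<and> F \<subseteq> I}"
  \<comment> \<open>For each promise \<open>(p, A)\<close> and each finite \<open>F\<close>, a
    member of \<open>\<H>\<close> inside \<open>A\<close> is chosen that lies almost in the cell cut
    down by \<open>W p\<close>; inserting \<open>e p\<close> does the cutting. The choices are
    countably many, so largeness treats them all at once.\<close>
  define b where "b = (\<lambda>((p, A), F). SOME B. B \<in> \<H> \<and> B \<subseteq> A \<and> almost_sub B (cell (m p) t (insert (e p) F)))"
  have b: "b ((p, A), F) \<in> \<H> \<and> b ((p, A), F) \<subseteq> A \<and> almost_sub (b ((p, A), F)) (cell (m p) t (insert (e p) F))"
    if "((p, A), F) \<in> R" for p A F
  proof -
    have "p \<in> P" using that Q'P by (auto simp: R_def)
    then have "\<exists>B. B \<in> \<H> \<and> B \<subseteq> A \<and> almost_sub B (cell (m p) t (insert (e p) F))"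
      using conv'[of p A "insert (e p) F"] that e by (auto simp: R_def)
    from someI_ex[OF this] show ?thesis by (simp add: b_def)
  qed
  have "countable (b ` R)" "b ` R \<subseteq> \<H>"
    using b Q'P(2) cI countable_Collect_finite_subset[OF cI] by (auto simp: R_def)
  then have "\<exists>T1. clop T1 \<and> (g \<in> \<G> \<longrightarrow> g \<subseteq> T1) \<and> (\<forall>A\<in>b ` R. A - T1 \<in> \<H>)"
    using large[of g "b ` R"] by (cases "g \<in> \<G>") (auto intro!: exI[of _ "{}"] simp: clop_def)
  then obtain T1 where T1: "clop T1" "g \<in> \<G> \<longrightarrow> g \<subseteq> T1" "\<And>r. r \<in> R \<Longrightarrow> b r - T1 \<in> \<H>" by blast
  have final: "\<exists>B\<in>\<H>. B \<subseteq> A \<and> almost_sub B (cell (m p) t F - (T0 \<union> T1))"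
    if r: "(p, A) \<in> Q'" "finite F" "F \<subseteq> I" for p A F
  proof -
    define B where "B = b ((p, A), F)"
    have R: "((p, A), F) \<in> R" and "p \<in> P" using r Q'P by (auto simp: R_def)
    have B: "B \<subseteq> A" "almost_sub B (cell (m p) t F \<inter> W p)"
      using b[OF R] by (auto simp: B_def cell_def W_def Int_commute)
    \<comment> \<open>Removing \<open>T1\<close> from \<open>B\<close> leaves a member of
      \<open>\<H>\<close> by largeness. Removing \<open>T0\<close> costs only finitely many levels,
      since \<open>B\<close> is almost inside \<open>W p\<close> and \<open>T0\<close> almost misses
      \<open>W p\<close>.\<close>
    have "fst ` (B - T1 - (cell (m p) t F - (T0 \<union> T1))) \<subseteq>
        fst ` (B - cell (m p) t F \<inter> W p) \<union> fst ` (T0 - - W p)" by blast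
    then have "almost_sub (B - T1) (cell (m p) t F - (T0 \<union> T1))"
      using B(2) T0W[OF \<open>p \<in> P\<close>] finite_subset finite_UnI unfolding almost_sub_def by blast
    then show ?thesis using B(1) T1(3)[OF R] unfolding B_def by blast
  qed
  have kT: "almost_sub k (T0 \<union> T1)" using \<open>k \<subseteq> T0\<close> by (simp add: almost_sub_def Diff_eq_empty_iff[THEN iffD2] le_supI1)
  have cT: "clop (T0 \<union> T1)" by (intro clop_Un \<open>clop T0\<close> T1)
  have gT: "g \<in> \<G> \<longrightarrow> g \<subseteq> T0 \<union> T1" using T1(2) by blast
  show ?thesis
    by (intro exI[of _ k] exI[of _ k'] exI[of _ "T0 \<union> T1"] exI[of _ Q'] conjI allI impI ballI
        k(1,2) cT k(3) kT k(4) gT[rule_format] Q' final)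
qed

end

section \<open>The recursion\<close>

text \<open>Generators fixed before the recursion, each a union of levels. Countably many points
  cannot exhaust their membership patterns, so there is always somewhere to put a new point.\<close>

definition bit_set :: "nat \<Rightarrow> cpt set" where
  "bit_set j = fst -` {n. j < length (from_nat n :: bool list) \<and> (from_nat n :: bool list) ! j}"

lemma clop_bit_set: "clop (bit_set j)"
  unfolding bit_set_def by (rule clop_fst_vimage)

text \<open>The sets bit_set j define a map from the set of levels to Cantor space with dense image; a
  sequence of levels converging to a value y omitted by countably many points avoids these points.\<close>
lemma exists_room:
  assumes "countable \<Phi>"
  shows "\<exists>w. clop w \<and> infinite (fst ` w) \<and> (\<forall>\<phi>\<in>\<Phi>. \<exists>j. almost_sub w (- side (\<phi> j) (bit_set j)))"
proof -
  define y where "y n \<longleftrightarrow> \<not> from_nat_into \<Phi> n n" for n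
  have y: "y \<notin> \<Phi>"
  proof
    assume "y \<in> \<Phi>"
    then obtain n where "from_nat_into \<Phi> n = y"
      using from_nat_into_surj[OF assms] by metis
    then show False using y_def[of n] by simp
  qed
  \<comment> \<open>\<open>l k\<close> is the level coding the first \<open>k\<close> bits of the
    diagonal sequence \<open>y\<close>. For \<open>k > j\<close> it belongs to
    \<open>bit_set j\<close> exactly when \<open>y j\<close> holds, so the levels in
    \<open>w\<close> follow the pattern \<open>y\<close>.\<close>
  define l where "l k = to_nat (map y [0..<k])" for k
  define w :: "cpt set" where "w = fst -` range l"
  have "inj l"
  proof (rule injI)
    fix j k assume "l j = l k"
    then have "map y [0..<j] = map y [0..<k]" by (simp add: l_def)
    from arg_cong[OF this, of length] show "j = k" by simp
  qed
  moreover have "fst ` w = range l" by (force simp: w_def)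
  ultimately have "infinite (fst ` w)" by (simp add: range_inj_infinite)
  moreover have "\<exists>j. almost_sub w (- side (\<phi> j) (bit_set j))" if "\<phi> \<in> \<Phi>" for \<phi>
  proof -
    have "\<phi> \<noteq> y" using that y by blast
    then obtain j where j: "\<phi> j = (\<not> y j)" by (auto simp: fun_eq_iff)
    have "fst c \<in> l ` {..j}" if c: "c \<in> w - - side (\<phi> j) (bit_set j)" for c
    proof -
      obtain k where k: "fst c = l k" using c unfolding w_def by blast
      have "c \<in> side (\<phi> j) (bit_set j)" using c by blast
      have "k \<le> j"
      proof (rule ccontr)
        assume "\<not> k \<le> j"
        then have "c \<in> bit_set j \<longleftrightarrow> y j" using k by (simp add: bit_set_def l_def)
        then show False using \<open>c \<in> side (\<phi> j) (bit_set j)\<close> j by (simp add: side_def split: if_splits)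
      qed
      then show ?thesis using k by auto
    qed
    then have "fst ` (w - - side (\<phi> j) (bit_set j)) \<subseteq> l ` {..j}" by blast
    then have "almost_sub w (- side (\<phi> j) (bit_set j))"
      unfolding almost_sub_def by (rule finite_surj[rotated]) simp
    then show ?thesis ..
  qed
  moreover have "clop w" unfolding w_def by (rule clop_fst_vimage)
  ultimately show ?thesis by blast
qed

text \<open>Stage x is a tuple (k, k', a, T): k converges to the point x, T generates the x-th clopen set,
  and k' is a subset of the x-th member of H to be handled, which converges to a \<le> x.\<close>
type_synonym 'w stage = "cpt set \<times> cpt set \<times> 'w \<times> cpt set"

definition stage_trace :: "('w \<Rightarrow> 'w stage) \<Rightarrow> nat + 'w \<Rightarrow> cpt set" where
  "stage_trace f i = (case i of Inl j \<Rightarrow> bit_set j | Inr x \<Rightarrow> snd (snd (snd (f x))))"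

text \<open>Only stages up to \<open>a\<close> are read, so the pattern of the point
  \<open>a\<close> is settled once stage \<open>a\<close> is chosen; later generators exclude
  \<open>a\<close> by decree.\<close>

definition memb :: "('w::wellorder \<Rightarrow> 'w stage) \<Rightarrow> 'w \<Rightarrow> nat + 'w \<Rightarrow> bool" where
  "memb f a i \<longleftrightarrow> (\<forall>x. i = Inr x \<longrightarrow> x \<le> a) \<and> almost_sub (fst (f a)) (stage_trace f i)"

text \<open>The closure promises made up to stage \<open>x\<close>. With \<open>a \<le> x\<close>
  demanded, testing a promise at \<open>x\<close> reads no later stage.\<close>

definition conv_pairs :: "('w::wellorder \<Rightarrow> 'w stage) \<Rightarrow> 'w \<Rightarrow> ('w \<times> cpt set) set" where
  "conv_pairs f x = {(a, A). a \<le> x \<and>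
    (\<exists>y\<le>x. (a, A) = (y, fst (f y)) \<or> (a, A) = (fst (snd (snd (f y))), fst (snd (f y))))}"

context large_family
begin

text \<open>A promise is kept through a witness \<open>B\<close> depending on \<open>F\<close>, as
  \<open>A\<close> itself need not converge to \<open>a\<close>. Requiring
  \<open>B \<in> \<H>\<close>, and not just a nonempty intersection, allows largeness to be applied
  again at later stages.\<close>

definition good :: "('w::wellorder \<Rightarrow> cpt set) \<Rightarrow> ('w \<Rightarrow> cpt set) \<Rightarrow> ('w \<Rightarrow> 'w stage) \<Rightarrow> 'w \<Rightarrow> bool" where
  "good h g f x \<longleftrightarrow> (case f x of (k, k', a, T) \<Rightarrow>
     k \<in> \<H> \<and> k' \<in> \<H> \<and> k' \<subseteq> h x \<and> a \<le> x \<and> clop T \<and> almost_sub k T \<and> (g x \<in> \<G> \<longrightarrow> g x \<subseteq> T)) \<and>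
   (\<forall>a A F. (a, A) \<in> conv_pairs f x \<longrightarrow> finite F \<longrightarrow> F \<subseteq> range Inl \<union> Inr ` {..x} \<longrightarrow>
     (\<exists>B\<in>\<H>. B \<subseteq> A \<and> almost_sub B (cell (memb f a) (stage_trace f) F)))"

text \<open>Recursion along the well-order requires this locality of the invariant.\<close>

lemma good_cong:
  assumes eq: "\<And>y. y \<le> x \<Longrightarrow> f y = f' y"
  shows "good h g f x = good h g f' x"
proof -
  have t: "stage_trace f i = stage_trace f' i" if "i \<in> range Inl \<union> Inr ` {..x}" for i
    using that eq by (auto simp: stage_trace_def)
  have m: "memb f a i = memb f' a i" if "i \<in> range Inl \<union> Inr ` {..x}" "a \<le> x" for a i
    unfolding memb_def t[OF that(1)] eq[OF that(2)] ..
  have "cell (memb f a) (stage_trace f) F = cell (memb f' a) (stage_trace f') F"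
    if "F \<subseteq> range Inl \<union> Inr ` {..x}" "a \<le> x" for a F
    using that by (intro cell_cong m t) auto
  moreover have "conv_pairs f x = conv_pairs f' x"
    unfolding conv_pairs_def using eq by auto
  moreover have "a \<le> x" if "(a, A) \<in> conv_pairs f' x" for a A
    using that by (simp add: conv_pairs_def)
  ultimately show ?thesis unfolding good_def eq[OF order_refl] by (metis (no_types, lifting))
qed

text \<open>\<open>extension_step\<close> is applied to the earlier points, the earlier generators
  with all \<open>bit_set j\<close>, and the earlier promises; all are countable because
  \<open>x\<close> has countably many predecessors.\<close>

lemma good_step:
  fixes f :: "'w::wellorder \<Rightarrow> 'w stage"
  assumes w1: "omega1_type TYPE('w)" and h: "h x \<in> \<H>"
    and IH: "\<And>y. y < x \<Longrightarrow> good h g f y"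
  shows "\<exists>d. good h g (f(x := d)) x"
proof -
  define I :: "(nat + 'w) set" where "I = range Inl \<union> Inr ` {..<x}"
  define Q where "Q = (\<lambda>y. (y, fst (f y))) ` {..<x} \<union>
    (\<lambda>y. (fst (snd (snd (f y))), fst (snd (f y)))) ` {..<x}"
  have cx: "countable {..<x}" using w1 by (simp add: omega1_type_def lessThan_def)
  have f: "fst (f y) \<in> \<H>" "fst (snd (f y)) \<in> \<H>" "fst (snd (snd (f y))) \<le> y" "clop (snd (snd (snd (f y))))"
    if "y < x" for y
    using IH[OF that] by (auto simp: good_def split: prod.splits)
  have conv: "\<forall>p A F. (p, A) \<in> Q \<longrightarrow> finite F \<longrightarrow> F \<subseteq> I \<longrightarrow>
    (\<exists>B\<in>\<H>. B \<subseteq> A \<and> almost_sub B (cell (memb f p) (stage_trace f) F))"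
  proof (intro allI impI)
    fix p A and F :: "(nat + 'w) set" assume pA: "(p, A) \<in> Q" and F: "finite F" "F \<subseteq> I"
    obtain y where y: "y < x" "(p, A) = (y, fst (f y)) \<or> (p, A) = (fst (snd (snd (f y))), fst (snd (f y)))"
      using pA by (auto simp: Q_def)
    \<comment> \<open>A finite \<open>F\<close> mentions finitely many stages, so the good stage
      \<open>Max Z < x\<close> already covers it, also when \<open>x\<close> is a limit. Including
      \<open>y\<close> ensures that the promise has been made by that stage.\<close>
    define Z where "Z = insert y (Inr -` F)"
    have "finite Z" unfolding Z_def using F(1) by (simp add: finite_vimageI)
    moreover have "Z \<subseteq> {..<x}" using F(2) y(1) by (auto simp: Z_def I_def)
    ultimately have z: "Max Z < x" "y \<le> Max Z" "F \<subseteq> range Inl \<union> Inr ` {..Max Z}"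
      using F(2) by (auto simp: Z_def I_def intro!: Max_ge)
    have "p \<le> y" using y f(3)[OF y(1)] by auto
    then have "(p, A) \<in> conv_pairs f (Max Z)"
      using y(2) z(2) by (auto simp: conv_pairs_def)
    then show "\<exists>B\<in>\<H>. B \<subseteq> A \<and> almost_sub B (cell (memb f p) (stage_trace f) F)"
      using IH[OF z(1)] F(1) z(3) unfolding good_def by blast
  qed
  obtain w where w: "clop w" "infinite (fst ` w)"
    "\<forall>\<phi>\<in>(\<lambda>p j. memb f p (Inl j)) ` {..<x}. \<exists>j. almost_sub w (- side (\<phi> j) (bit_set j))"
    using exists_room[OF countable_image[OF cx]] by metis
  have w': "\<forall>p\<in>{..<x}. \<exists>i\<in>I. almost_sub w (- side (memb f p i) (stage_trace f i))"
  proof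
    fix p assume "p \<in> {..<x}"
    obtain j where "almost_sub w (- side (memb f p (Inl j)) (bit_set j))" 
      using w(3)[rule_format, OF imageI[OF \<open>p \<in> {..<x}\<close>]] by blast
    then show "\<exists>i\<in>I. almost_sub w (- side (memb f p i) (stage_trace f i))"
      by (intro bexI[of _ "Inl j"]) (auto simp: I_def stage_trace_def)
  qed
  have cIQ: "countable I" "countable Q" using cx by (auto simp: I_def Q_def)
  have QH: "Q \<subseteq> {..<x} \<times> \<H>" using f le_less_trans[OF f(3)] by (auto simp: Q_def)
  have clopt: "\<forall>i\<in>I. clop (stage_trace f i)"
    using f(4) by (auto simp: I_def stage_trace_def clop_bit_set)
  note step = extension_step[where t = "stage_trace f" and m = "memb f" and I = I and P = "{..<x}" and Q = Q
      and w = w and h = "h x" and g = "g x", OF cIQ(1) cx cIQ(2) QH clopt conv w(1,2) w' h]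
  obtain k k' T Q' where k: "k \<in> \<H>" "k' \<in> \<H>" "clop T" "k' \<subseteq> h x" "almost_sub k T"
      "\<forall>i\<in>I. almost_sub k (stage_trace f i) \<or> almost_sub k (- stage_trace f i)" "g x \<in> \<G> \<longrightarrow> g x \<subseteq> T"
    and Q': "Q' = Q \<and> k' = k \<or> (\<exists>p\<in>{..<x}. Q' = insert (p, k') Q)"
    and conv': "\<forall>p A F. (p, A) \<in> Q' \<longrightarrow> finite F \<longrightarrow> F \<subseteq> I \<longrightarrow>
      (\<exists>B\<in>\<H>. B \<subseteq> A \<and> almost_sub B (cell (memb f p) (stage_trace f) F - T))"
    using step by (elim exE conjE) (rule that)
  \<comment> \<open>Stage \<open>x\<close> assigns \<open>k'\<close> either to the new point, with
    \<open>k' = k\<close>, or to the old point to which \<open>k'\<close> converges.\<close>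
  obtain a where a: "a = x \<and> k' = k \<or> a < x \<and> (a, k') \<in> Q'" using Q' by blast
  have "Q \<subseteq> Q'" using Q' by blast
  have Ix: "range Inl \<union> Inr ` {..x} = insert (Inr x) I" by (auto simp: I_def le_less)
  define f' where "f' = f(x := (k, k', a, T))"
  have f'x: "f' x = (k, k', a, T)" and f'y: "\<And>y. y < x \<Longrightarrow> f' y = f y"
    by (auto simp: f'_def)
  have t: "stage_trace f' i = stage_trace f i" if "i \<in> I" for i
    using that f'y by (auto simp: I_def stage_trace_def simp del: snd_conv)
  have tx: "stage_trace f' (Inr x) = T" by (simp add: stage_trace_def f'x)
  have m: "memb f' p i = memb f p i" if "i \<in> I" "p < x" for i p
    unfolding memb_def t[OF that(1)] using that(2) by (simp add: f'y)
  \<comment> \<open>Old points lie outside the new generator, so putting \<open>Inr x\<close> into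
    \<open>F\<close> shrinks their cells exactly by \<open>T\<close>.\<close>
  have mx: "\<not> memb f' p (Inr x)" if "p < x" for p
    using that by (auto simp: memb_def)
  have old: "\<exists>B\<in>\<H>. B \<subseteq> A \<and> almost_sub B (cell (memb f' p) (stage_trace f') F)"
    if pA: "(p, A) \<in> Q'" and "p < x" and fin: "finite F" and FI: "F \<subseteq> range Inl \<union> Inr ` {..x}" for p A F
  proof -
    have F: "F - {Inr x} \<subseteq> I" using FI Ix by blast
    obtain B where B: "B \<in> \<H>" "B \<subseteq> A" "almost_sub B (cell (memb f p) (stage_trace f) (F - {Inr x}) - T)"
      using conv'[rule_format, OF pA _ F] fin by blast
    have "cell (memb f p) (stage_trace f) (F - {Inr x}) = cell (memb f' p) (stage_trace f') (F - {Inr x})"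
      using F \<open>p < x\<close> by (intro cell_cong) (auto simp: t m)
    moreover have "cell (memb f' p) (stage_trace f') (F - {Inr x}) - T \<subseteq> cell (memb f' p) (stage_trace f') F"
      using mx[OF \<open>p < x\<close>] tx by (auto simp: cell_def side_def)
    ultimately show ?thesis using B almost_sub_mono by (metis order_refl)
  qed
  \<comment> \<open>\<open>k\<close> decides every generator up to \<open>x\<close>, and
    \<open>memb f' x\<close> records the side it chooses.\<close>
  have new: "almost_sub k (cell (memb f' x) (stage_trace f') F)"
    if "finite F" "F \<subseteq> range Inl \<union> Inr ` {..x}" for F
    unfolding cell_def
  proof (rule almost_sub_INT[OF that(1)])
    fix i assume "i \<in> F"
    then have i: "i = Inr x \<or> i \<in> I" and "\<forall>y. i = Inr y \<longrightarrow> y \<le> x" using that(2) Ix by blast+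
    then have "memb f' x i \<longleftrightarrow> almost_sub k (stage_trace f' i)" by (auto simp: memb_def f'x)
    then show "almost_sub k (side (memb f' x i) (stage_trace f' i))"
      using i k(5,6) t tx by (auto simp: side_def)
  qed
  have "\<exists>B\<in>\<H>. B \<subseteq> A \<and> almost_sub B (cell (memb f' p) (stage_trace f') F)"
    if pA: "(p, A) \<in> conv_pairs f' x" and FF: "finite F" "F \<subseteq> range Inl \<union> Inr ` {..x}" for p A F
  proof -
    obtain y where y: "y \<le> x" "(p, A) = (y, fst (f' y)) \<or> (p, A) = (fst (snd (snd (f' y))), fst (snd (f' y)))"
      using pA by (auto simp: conv_pairs_def)
    have "(p, A) = (x, k) \<or> p < x \<and> (p, A) \<in> Q'"
    proof (cases "y = x")
      case True
      then show ?thesis using y(2) a by (auto simp: f'x)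
    next
      case False
      then have "y < x" using y(1) by simp
      then have "(p, A) \<in> Q" "p < x"
        using y(2) f(3)[of y] le_less_trans by (auto simp: f'y Q_def)
      then show ?thesis using \<open>Q \<subseteq> Q'\<close> by blast
    qed
    then show ?thesis
    proof
      assume "(p, A) = (x, k)"
      then show ?thesis using new[OF FF] k(1) by auto
    qed (use old FF in blast)
  qed
  moreover have "a \<le> x" using a by auto
  ultimately have "good h g f' x"
    unfolding good_def using k by (simp add: f'x)
  then show ?thesis unfolding f'_def by blast
qed

lemma good_exists:
  fixes h g :: "'w::wellorder \<Rightarrow> cpt set"
  assumes w1: "omega1_type TYPE('w)" and h: "\<And>x. h x \<in> \<H>"
  obtains f where "\<And>x. good h g f x"
proof -
  \<comment> \<open>The choice principle takes the value at \<open>x\<close> as a separate argument,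
    while \<open>good\<close> reads it from the function; the update supplies it.\<close>
  have "\<exists>f. \<forall>x. good h g (f(x := f x)) x"
  proof (rule dependent_wellorder_choice)
    fix r and f f' :: "'w \<Rightarrow> 'w stage" and x
    assume "\<And>y. y < x \<Longrightarrow> f y = f' y"
    then show "good h g (f(x := r)) x = good h g (f'(x := r)) x" by (intro good_cong) auto
  next
    fix x and f :: "'w \<Rightarrow> 'w stage" assume "\<And>y. y < x \<Longrightarrow> good h g (f(y := f y)) y"
    then show "\<exists>r. good h g (f(x := r)) x" by (intro good_step[OF w1 h]) simp
  qed
  then show ?thesis using that by auto
qed

text \<open>Stage \<open>x\<close> serves a representative of the sets with closure
  \<open>e x\<close>, and thereby all of them: a closed generator covering one covers all, and an
  open cell meeting one meets all. Each closed set recurs cofinally, so covering generators occur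
  beyond every point.\<close>

lemma point_data_exist:
  assumes w1: "omega1_type TYPE('w::wellorder)"
    and CH: "\<exists>f :: 'w \<Rightarrow> (nat \<Rightarrow> bool). bij f"
  obtains t :: "nat + 'w::wellorder \<Rightarrow> cpt set" and m :: "'w \<Rightarrow> nat + 'w \<Rightarrow> bool"
  where "\<And>i. clop (t i)" "\<And>a x. m a (Inr x) \<Longrightarrow> x \<le> a" "\<And>a. m a (Inr a)"
    "\<And>a F M. finite F \<Longrightarrow> finite M \<Longrightarrow> \<exists>c\<in>cell (m a) t F. fst c \<notin> M"
    "\<And>A a. A \<in> \<G> \<Longrightarrow> \<exists>x>a. A \<subseteq> t (Inr x)"
    "\<And>A. A \<in> \<H> \<Longrightarrow> \<exists>a. \<forall>F M. finite F \<longrightarrow> finite M \<longrightarrow> (\<exists>c\<in>A \<inter> cell (m a) t F. fst c \<notin> M)"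
proof -
  obtain e :: "'w \<Rightarrow> cpt set" where e: "\<And>S a. closed S \<Longrightarrow> \<exists>b>a. e b = S"
    using unbounded_enumeration_closed_sets[OF w1 CH] by blast
  have "infinite (fst ` (UNIV :: cpt set))" by simp
  then obtain A0 where A0: "A0 \<in> \<H>" using dense[of UNIV] by (auto simp: clop_def)
  \<comment> \<open>The default \<open>A0\<close> gives every stage a member of \<open>\<H>\<close>
    to work on, even if \<open>e x\<close> is the closure of none.\<close>
  define h where "h x = (if \<exists>A\<in>\<H>. closure A = e x then SOME A. A \<in> \<H> \<and> closure A = e x else A0)" for x
  define g where "g x = (SOME A. A \<in> \<G> \<and> closure A = e x)" for x
  have h: "h x \<in> \<H> \<and> ((\<exists>A\<in>\<H>. closure A = e x) \<longrightarrow> closure (h x) = e x)" for x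
  proof (cases "\<exists>A\<in>\<H>. closure A = e x")
    case True
    then have "\<exists>A. A \<in> \<H> \<and> closure A = e x" by blast
    from someI_ex[OF this] show ?thesis unfolding h_def using True by simp
  qed (use A0 in \<open>auto simp: h_def\<close>)
  have g: "g x \<in> \<G> \<and> closure (g x) = e x" if "A \<in> \<G>" "closure A = e x" for A x
    unfolding g_def by (rule someI[of _ A]) (use that in blast)
  obtain f where f: "\<And>x. good h g f x" using good_exists[OF w1, of h g] h by blast
  define k where "k x = fst (f x)" for x
  define k' where "k' x = fst (snd (f x))" for x
  define p where "p x = fst (snd (snd (f x)))" for x
  have fx: "f x = (k x, k' x, p x, stage_trace f (Inr x))" for x
    by (simp add: k_def k'_def p_def stage_trace_def)
  have f1: "k x \<in> \<H>" "k' x \<in> \<H>" "k' x \<subseteq> h x" "p x \<le> x" "clop (stage_trace f (Inr x))"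
    "almost_sub (k x) (stage_trace f (Inr x))" "g x \<in> \<G> \<Longrightarrow> g x \<subseteq> stage_trace f (Inr x)" for x
    using f[of x] unfolding good_def fx[of x] by auto
  have conv: "\<exists>c\<in>A \<inter> cell (memb f a) (stage_trace f) F. fst c \<notin> M"
    if aA: "a = x \<and> A = k x \<or> a = p x \<and> A = k' x" and F: "finite F" and M: "finite M" for a A x F M
  proof -
    define Z where "Z = insert x (Inr -` F)"
    have "finite Z" unfolding Z_def using F by (simp add: finite_vimageI)
    then have le: "y \<le> Max Z" if "y \<in> Z" for y using that by simp
    have z1: "x \<le> Max Z" by (rule le) (simp add: Z_def)
    have z2: "F \<subseteq> range Inl \<union> Inr ` {..Max Z}"
    proof
      fix i assume "i \<in> F"
      then show "i \<in> range Inl \<union> Inr ` {..Max Z}"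
        using le by (cases i) (auto simp: Z_def)
    qed
    have "p x \<le> x" by (rule f1)
    then have "(a, A) \<in> conv_pairs f (Max Z)"
      using aA z1 by (auto simp: conv_pairs_def k_def k'_def p_def)
    then obtain B where B: "B \<in> \<H>" "B \<subseteq> A" "almost_sub B (cell (memb f a) (stage_trace f) F)"
      using f[of "Max Z"] z2 F unfolding good_def by blast
    then show ?thesis using almost_sub_meets[OF B(3) infinite_fst[OF B(1)] M] by blast
  qed
  have clopt: "clop (stage_trace f i)" for i
    using f1(5) by (cases i) (auto simp: stage_trace_def clop_bit_set)
  show ?thesis
  proof (rule that[of "stage_trace f" "memb f"])
    show "clop (stage_trace f i)" for i by (rule clopt)
    show "memb f a (Inr x) \<Longrightarrow> x \<le> a" for a x by (simp add: memb_def)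
    show "memb f a (Inr a)" for a using f1(6) by (simp add: memb_def k_def)
    show "\<exists>c\<in>cell (memb f a) (stage_trace f) F. fst c \<notin> M" if "finite F" "finite M" for a F M
      using conv[of a a "k a", OF _ that] by blast
    show "\<exists>x>a. A \<subseteq> stage_trace f (Inr x)" if "A \<in> \<G>" for A a
    proof -
      obtain x where x: "x > a" "e x = closure A" using e[of "closure A"] by auto
      then have "g x \<subseteq> stage_trace f (Inr x)" "closure (g x) = closure A"
        using g[OF that, of x] f1(7)[of x] by auto
      then have "closure A \<subseteq> stage_trace f (Inr x)"
        using clopt[of "Inr x"] closure_minimal by (metis clop_def)
      then show ?thesis using x(1) closure_subset by blast
    qed
    show "\<exists>a. \<forall>F M. finite F \<longrightarrow> finite M \<longrightarrow> (\<exists>c\<in>A \<inter> cell (memb f a) (stage_trace f) F. fst c \<notin> M)"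
      if A: "A \<in> \<H>" for A
    proof -
      obtain x where x: "e x = closure A" using e[of "closure A"] by auto
      have "\<exists>c\<in>A \<inter> cell (memb f (p x)) (stage_trace f) F. fst c \<notin> M"
        if FM: "finite F" "finite M" for F :: "(nat + 'w) set" and M :: "nat set"
      proof -
        obtain c where c: "c \<in> k' x \<inter> cell (memb f (p x)) (stage_trace f) F" "fst c \<notin> M"
          using conv[of "p x" x "k' x", OF _ FM] by blast
        \<comment> \<open>\<open>S\<close> is open and meets the closure of \<open>A\<close> at
          \<open>c\<close>, so it meets \<open>A\<close> itself.\<close>
        define S where "S = cell (memb f (p x)) (stage_trace f) F \<inter> fst -` (- M)"
        have "open S" unfolding S_def using clop_Int[OF clop_cell[OF FM(1) clopt] clop_fst_vimage]
          by (auto simp: clop_def)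
        moreover have "c \<in> closure A" using c(1) f1(3)[of x] h[of x] x A closure_subset[of "h x"] by blast
        moreover have "c \<in> S" using c by (simp add: S_def)
        ultimately obtain d where "d \<in> A \<inter> S" unfolding closure_iff_nhds_not_empty by blast
        then show ?thesis by (auto simp: S_def)
      qed
      then show ?thesis by blast
    qed
  qed
qed

end

section \<open>The topology\<close>

text \<open>What the topology uses of the construction: \<open>m a i\<close> tells whether the point
  \<open>a\<close> belongs to the generator whose trace on C is \<open>t i\<close>.\<close>

locale point_data =
  fixes t :: "nat + 'w::wellorder \<Rightarrow> cpt set" and m :: "'w \<Rightarrow> nat + 'w \<Rightarrow> bool"
  assumes w1: "omega1_type TYPE('w)"
    and clop_t: "clop (t i)"
    and m_le: "m a (Inr x) \<Longrightarrow> x \<le> a"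
    and m_self: "m a (Inr a)"
    and cell_meets: "finite F \<Longrightarrow> finite M \<Longrightarrow> \<exists>c\<in>cell (m a) t F. fst c \<notin> M"
begin

text \<open>Discarding the levels in \<open>M\<close> turns almost inclusion in a cell into
  inclusion and separates each level of C from the added points.\<close>

definition nbhd :: "'w \<Rightarrow> (nat + 'w) set \<Rightarrow> nat set \<Rightarrow> (cpt + 'w) set" where
  "nbhd a F M = Inl ` (cell (m a) t F \<inter> fst -` (- M)) \<union> Inr ` {b. \<forall>i\<in>F. m b i = m a i}"

definition point_top :: "(cpt + 'w) topology" where
  "point_top = topology (\<lambda>S. open (Inl -` S) \<and>
     (\<forall>a. Inr a \<in> S \<longrightarrow> (\<exists>F M. finite F \<and> finite M \<and> nbhd a F M \<subseteq> S)))"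

lemma nbhd_Un: "nbhd a (F \<union> F') (M \<union> M') \<subseteq> nbhd a F M \<inter> nbhd a F' M'"
  by (auto simp: nbhd_def cell_def)

lemma Inl_nbhd: "Inl -` nbhd a F M = cell (m a) t F \<inter> fst -` (- M)"
  by (auto simp: nbhd_def)

lemma Inr_nbhd: "Inr b \<in> nbhd a F M \<longleftrightarrow> (\<forall>i\<in>F. m b i = m a i)"
  by (auto simp: nbhd_def)

lemma openin_point_top: "openin point_top S \<longleftrightarrow> open (Inl -` S) \<and>
    (\<forall>a. Inr a \<in> S \<longrightarrow> (\<exists>F M. finite F \<and> finite M \<and> nbhd a F M \<subseteq> S))"
proof -
  have "istopology (\<lambda>S. open (Inl -` S) \<and>
     (\<forall>a. Inr a \<in> S \<longrightarrow> (\<exists>F M. finite F \<and> finite M \<and> nbhd a F M \<subseteq> S)))"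
    unfolding istopology_def
  proof (intro conjI allI impI)
    fix S T :: "(cpt + 'w) set" and a
    assume S: "open (Inl -` S) \<and> (\<forall>a. Inr a \<in> S \<longrightarrow> (\<exists>F M. finite F \<and> finite M \<and> nbhd a F M \<subseteq> S))"
      and T: "open (Inl -` T) \<and> (\<forall>a. Inr a \<in> T \<longrightarrow> (\<exists>F M. finite F \<and> finite M \<and> nbhd a F M \<subseteq> T))"
    show "open (Inl -` (S \<inter> T))" using S T by (simp add: vimage_Int open_Int)
    assume "Inr a \<in> S \<inter> T"
    then obtain F M F' M' where "finite F" "finite M" "nbhd a F M \<subseteq> S"
      "finite F'" "finite M'" "nbhd a F' M' \<subseteq> T" using S T by blast
    then show "\<exists>F M. finite F \<and> finite M \<and> nbhd a F M \<subseteq> S \<inter> T"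
      using nbhd_Un[of a F F' M M'] by (intro exI[of _ "F \<union> F'"] exI[of _ "M \<union> M'"]) auto
  next
    fix \<S> :: "(cpt + 'w) set set" and a
    assume \<S>: "\<forall>S\<in>\<S>. open (Inl -` S) \<and>
      (\<forall>a. Inr a \<in> S \<longrightarrow> (\<exists>F M. finite F \<and> finite M \<and> nbhd a F M \<subseteq> S))"
    show "open (Inl -` \<Union>\<S>)" using \<S> by (auto simp: vimage_Union)
    assume "Inr a \<in> \<Union>\<S>"
    then obtain S where S: "S \<in> \<S>" "Inr a \<in> S" by blast
    obtain F M where "finite F" "finite M" "nbhd a F M \<subseteq> S"
      using \<S>[rule_format, OF S(1)] S(2) by blast
    then show "\<exists>F M. finite F \<and> finite M \<and> nbhd a F M \<subseteq> \<Union>\<S>"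
      using S(1) by (meson Union_upper subset_trans)
  qed
  then show ?thesis by (simp add: point_top_def)
qed

lemma topspace_point_top [simp]: "topspace point_top = UNIV"
proof -
  have "openin point_top UNIV" unfolding openin_point_top by auto
  then show ?thesis using openin_subset by blast
qed

lemma closedin_point_top: "closedin point_top S \<longleftrightarrow> openin point_top (- S)"
  by (simp add: closedin_def Compl_eq_Diff_UNIV)

section \<open>Clopen sets of the space\<close>

lemma nbhd_disjoint:
  assumes "Inr b \<notin> nbhd a F M"
  shows "nbhd b F M \<inter> nbhd a F M = {}"
proof -
  obtain i where i: "i \<in> F" "m b i \<noteq> m a i" using assms by (auto simp: Inr_nbhd)
  then have "side (m b i) (t i) \<inter> side (m a i) (t i) = {}" by (auto simp: side_def)
  then have "cell (m b) t F \<inter> cell (m a) t F = {}" using i(1) unfolding cell_def by blast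
  moreover have "{c. \<forall>i\<in>F. m c i = m b i} \<inter> {c. \<forall>i\<in>F. m c i = m a i} = {}" using i by auto
  ultimately show ?thesis unfolding nbhd_def by blast
qed

lemma nbhd_eq:
  assumes "Inr b \<in> nbhd a F M"
  shows "nbhd b F M = nbhd a F M"
proof -
  have eq: "\<And>i. i \<in> F \<Longrightarrow> m b i = m a i" using assms by (simp add: Inr_nbhd)
  have "cell (m b) t F = cell (m a) t F" by (rule cell_cong[OF eq refl])
  then show ?thesis using eq by (simp add: nbhd_def)
qed

lemma clop_Inl_nbhd: "finite F \<Longrightarrow> clop (Inl -` nbhd a F M)"
  unfolding Inl_nbhd by (intro clop_Int clop_cell clop_t clop_fst_vimage)

text \<open>By \<open>nbhd_eq\<close> the set is the basic neighbourhood of each of its added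
  points. Closedness comes dually from \<open>nbhd_disjoint\<close>.\<close>

lemma openin_nbhd: "finite F \<Longrightarrow> finite M \<Longrightarrow> openin point_top (nbhd a F M)"
  unfolding openin_point_top using clop_Inl_nbhd nbhd_eq clop_def by (metis order_refl)

lemma closedin_nbhd: "finite F \<Longrightarrow> finite M \<Longrightarrow> closedin point_top (nbhd a F M)"
  unfolding closedin_point_top openin_point_top
proof (intro conjI allI impI)
  assume "finite F" "finite M"
  then show "open (Inl -` (- nbhd a F M))"
    using clop_Inl_nbhd[of F a M] by (simp add: clop_def closed_def vimage_Compl)
  fix b assume "Inr b \<in> - nbhd a F M"
  then show "\<exists>F' M'. finite F' \<and> finite M' \<and> nbhd b F' M' \<subseteq> - nbhd a F M"
    using nbhd_disjoint[of b a F M] \<open>finite F\<close> \<open>finite M\<close> by blast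
qed

lemma self_nbhd: "Inr a \<in> nbhd a F M"
  by (simp add: Inr_nbhd)

lemma openin_Inl: "open S \<Longrightarrow> openin point_top (Inl ` S)"
  by (auto simp: openin_point_top inj_vimage_image_eq)

text \<open>Deleting level \<open>n\<close> from a neighbourhood of an added point separates it from
  \<open>K\<close>.\<close>

lemma closedin_Inl_level:
  assumes "clop K" "fst ` K \<subseteq> {n}"
  shows "closedin point_top (Inl ` K)"
  unfolding closedin_point_top openin_point_top
proof (intro conjI allI impI)
  have "Inl -` (- (Inl ` K :: (cpt + 'w) set)) = - K" by auto
  then show "open (Inl -` (- (Inl ` K :: (cpt + 'w) set)))" using assms(1) by (simp add: clop_def closed_def)
  fix a
  have "nbhd a {} {n} \<subseteq> - Inl ` K" using assms(2) by (auto simp: nbhd_def)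
  then show "\<exists>F M. finite F \<and> finite M \<and> nbhd a F M \<subseteq> - Inl ` K"
    by (intro exI[of _ "{}"] exI[of _ "{n}"]) auto
qed

definition point_ext :: "nat + 'w \<Rightarrow> (cpt + 'w) set" where
  "point_ext i = Inl ` t i \<union> Inr ` {a. m a i}"

lemma openin_ext: "openin point_top (point_ext i)"
  unfolding openin_point_top
proof (intro conjI allI impI)
  have "Inl -` point_ext i = t i" by (auto simp: point_ext_def)
  then show "open (Inl -` point_ext i)" using clop_t[of i] by (simp add: clop_def)
  fix a assume "Inr a \<in> point_ext i"
  then have "nbhd a {i} {} \<subseteq> point_ext i" by (auto simp: point_ext_def nbhd_def cell_def side_def)
  then show "\<exists>F M. finite F \<and> finite M \<and> nbhd a F M \<subseteq> point_ext i"
    by (intro exI[of _ "{i}"] exI[of _ "{}"]) auto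
qed

lemma closedin_ext: "closedin point_top (point_ext i)"
  unfolding closedin_point_top openin_point_top
proof (intro conjI allI impI)
  have "Inl -` (- point_ext i) = - t i" by (auto simp: point_ext_def)
  then show "open (Inl -` (- point_ext i))" using clop_t[of i] by (simp add: clop_def closed_def)
  fix a assume "Inr a \<in> - point_ext i"
  then have "\<not> m a i" by (auto simp: point_ext_def)
  then have "nbhd a {i} {} \<subseteq> - point_ext i" by (auto simp: point_ext_def nbhd_def cell_def side_def)
  then show "\<exists>F M. finite F \<and> finite M \<and> nbhd a F M \<subseteq> - point_ext i"
    by (intro exI[of _ "{i}"] exI[of _ "{}"]) auto
qed

lemma clopen_nbhd_Inl:
  assumes "openin point_top S" "Inl c \<in> S"
  obtains K where "openin point_top (Inl ` K)" "closedin point_top (Inl ` K)" "c \<in> K" "Inl ` K \<subseteq> S"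
proof -
  have "open (Inl -` S)" "c \<in> Inl -` S" using assms by (auto simp: openin_point_top)
  then obtain p where p: "c \<in> cylinder p" "cylinder p \<subseteq> Inl -` S" by (rule cylinder_basis)
  define K where "K = cylinder p \<inter> fst -` {fst c}"
  have K: "clop K" "fst ` K \<subseteq> {fst c}"
    unfolding K_def by (auto intro!: clop_Int clop_cylinder clop_fst_vimage)
  show ?thesis
  proof (rule that)
    show "openin point_top (Inl ` K)" using K(1) by (intro openin_Inl) (simp add: clop_def)
    show "closedin point_top (Inl ` K)" using K by (rule closedin_Inl_level)
    show "c \<in> K" "Inl ` K \<subseteq> S" using p by (auto simp: K_def)
  qed
qed

section \<open>Zero-dimensionality, separation and left-separation\<close>

lemma zero_dimensional: "point_top dim_le 0"
proof -
  have "\<exists>U. (closedin point_top U \<and> openin point_top U) \<and> x \<in> U \<and> U \<subseteq> W"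
    if W: "openin point_top W" "x \<in> W" for W x
  proof (cases x)
    case (Inl c)
    then have "Inl c \<in> W" using W(2) by simp
    with W(1) show ?thesis
      by (rule clopen_nbhd_Inl) (use Inl in blast)
  next
    case (Inr a)
    then obtain F M where "finite F" "finite M" "nbhd a F M \<subseteq> W"
      using W by (auto simp: openin_point_top)
    then show ?thesis
      by (intro exI[of _ "nbhd a F M"]) (auto simp: openin_nbhd closedin_nbhd self_nbhd Inr)
  qed
  then show ?thesis
    unfolding dimension_le_0_neighbourhood_base_of_clopen
    by (subst open_neighbourhood_base_of) auto
qed

text \<open>Clopen separation is symmetric by complements, so two cases suffice: a point of C has a
  clopen neighbourhood within C avoiding the other point, and for \<open>a < b\<close> the
  \<open>b\<close>-th generator contains \<open>b\<close> but not \<open>a\<close>.\<close>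

lemma Hausdorff: "Hausdorff_space point_top"
proof -
  define sep where "sep x y \<longleftrightarrow> (\<exists>U. openin point_top U \<and> closedin point_top U \<and> x \<in> U \<and> y \<notin> U)"
    for x y :: "cpt + 'w"
  have sym: "sep y x" if "sep x y" for x y
  proof -
    obtain U where "openin point_top U" "closedin point_top U" "x \<in> U" "y \<notin> U"
      using \<open>sep x y\<close> unfolding sep_def by blast
    then show ?thesis unfolding sep_def
      by (intro exI[of _ "- U"]) (auto simp: closedin_point_top)
  qed
  have Inl: "sep (Inl c) y" if "Inl c \<noteq> y" for c y
  proof -
    have "open (- Inl -` {y} :: cpt set)"
    proof (cases y)
      case (Inl d)
      then have "Inl -` {y} = {d}" by auto
      then show ?thesis by (simp add: closed_singleton_cpt open_Compl)
    next
      case (Inr a)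
      then have "Inl -` {y} = ({} :: cpt set)" by auto
      then show ?thesis by simp
    qed
    then have "openin point_top (Inl ` (- Inl -` {y}))" by (rule openin_Inl)
    moreover have "Inl c \<in> Inl ` (- Inl -` {y})" using that by auto
    ultimately obtain K where "openin point_top (Inl ` K)" "closedin point_top (Inl ` K)" "c \<in> K"
      "Inl ` K \<subseteq> (Inl ` (- Inl -` {y}) :: (cpt + 'w) set)" by (rule clopen_nbhd_Inl)
    then show ?thesis unfolding sep_def by (intro exI[of _ "Inl ` K"]) auto
  qed
  have Inr: "sep (Inr b) (Inr a)" if "a < b" for a b
    unfolding sep_def using openin_ext closedin_ext m_self m_le[of a b] that
    by (intro exI[of _ "point_ext (Inr b)"]) (auto simp: point_ext_def)
  have "sep x y" if "x \<noteq> y" for x y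
  proof (cases x; cases y)
    fix a b assume "x = Inr a" "y = Inr b"
    then show ?thesis using Inr sym \<open>x \<noteq> y\<close> by (metis linorder_neq_iff)
  qed (use \<open>x \<noteq> y\<close> Inl sym in auto)
  then have "\<exists>U. openin point_top U \<and> openin point_top (- U) \<and> x \<in> U \<and> y \<in> - U" if "x \<noteq> y" for x y
    using that unfolding sep_def closedin_point_top by (metis ComplI)
  then show ?thesis unfolding Hausdorff_space_def disjnt_def by (metis Compl_disjoint)
qed

text \<open>Generators with index at least \<open>a\<close> contain no point below \<open>a\<close>,
  and each \<open>b \<ge> a\<close> lies in its own generator. Their open union therefore meets the
  added points exactly in the final segment from \<open>a\<close>.\<close>

lemma left_separated: "closedin (subtopology point_top (range Inr)) (Inr ` {b. b < a})"
proof -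
  have "openin point_top (\<Union>b\<in>{a..}. point_ext (Inr b))" using openin_ext by blast
  then have "closedin point_top (- (\<Union>b\<in>{a..}. point_ext (Inr b)))" by (simp add: closedin_point_top)
  moreover have "Inr ` {b. b < a} = - (\<Union>b\<in>{a..}. point_ext (Inr b)) \<inter> range Inr"
  proof -
    have "b < a \<longleftrightarrow> (\<forall>x\<in>{a..}. Inr b \<notin> point_ext (Inr x))" for b
      using m_self[of b] m_le[of b] by (auto simp: point_ext_def not_less) (meson le_less_trans not_less)
    then show ?thesis by (auto simp: image_iff)
  qed
  ultimately show ?thesis unfolding closedin_subtopology by blast
qed

section \<open>Closures and the dense open copy of C\<close>

lemma closure_nbhdI:
  assumes "\<And>F M. finite F \<Longrightarrow> finite M \<Longrightarrow> \<exists>y\<in>A. y \<in> nbhd a F M"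
  shows "Inr a \<in> point_top closure_of A"
  unfolding in_closure_of
proof (intro conjI allI impI)
  fix T assume "Inr a \<in> T \<and> openin point_top T"
  then obtain F M where "finite F" "finite M" "nbhd a F M \<subseteq> T" by (auto simp: openin_point_top)
  then show "\<exists>y. y \<in> A \<and> y \<in> T" using assms[of F M] by blast
qed simp

lemma closure_nbhdD:
  assumes "Inr a \<in> point_top closure_of A" "finite F" "finite M"
  shows "\<exists>y\<in>A. y \<in> nbhd a F M"
  using assms(1)[unfolded in_closure_of, THEN conjunct2, rule_format, of "nbhd a F M"]
    openin_nbhd[OF assms(2,3)] self_nbhd by auto

lemma dense_Inl: "point_top closure_of range Inl = UNIV"
proof -
  have "Inr a \<in> point_top closure_of range Inl" for a
  proof (rule closure_nbhdI)
    fix F :: "(nat + 'w) set" and M :: "nat set" assume "finite F" "finite M"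
    then obtain c where "c \<in> cell (m a) t F" "fst c \<notin> M" using cell_meets by blast
    then show "\<exists>y\<in>range Inl. y \<in> nbhd a F M"
      by (intro bexI[of _ "Inl c"]) (auto simp: nbhd_def)
  qed
  moreover have "Inl c \<in> point_top closure_of range Inl" for c
    using closure_of_subset[of "range Inl" point_top] by auto
  ultimately show ?thesis by (metis UNIV_eq_I sum.exhaust)
qed

lemma homeomorphic_Inl: "homeomorphic_map euclidean (subtopology point_top (range Inl)) Inl"
proof (rule bijective_open_imp_homeomorphic_map)
  show "continuous_map euclidean (subtopology point_top (range Inl)) Inl"
    unfolding continuous_map_in_subtopology
    by (auto simp: continuous_map_def openin_point_top vimage_def)
  show "open_map euclidean (subtopology point_top (range Inl)) Inl"
    unfolding open_map_def openin_subtopology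
  proof (intro allI impI)
    fix U :: "cpt set" assume "openin euclidean U"
    then show "\<exists>T. openin point_top T \<and> Inl ` U = T \<inter> range Inl"
      by (intro exI[of _ "Inl ` U"]) (auto simp: openin_Inl)
  qed
qed auto

section \<open>Regularity of omega_1 and countable tightness\<close>

lemma bounded_countable:
  assumes "countable (Z :: 'w set)"
  shows "\<exists>b. \<forall>z\<in>Z. z \<le> b"
proof (rule ccontr)
  assume "\<not> ?thesis"
  then have "UNIV = (\<Union>z\<in>Z. {b. b < z})" by (auto simp: not_le)
  moreover have "countable (\<Union>z\<in>Z. {b. b < z})" using w1 assms by (auto simp: omega1_type_def)
  ultimately show False using w1 by (simp add: omega1_type_def)
qed

lemma countable_atMost: "countable {..b :: 'w}"
proof -
  have "{..b} = insert b {a. a < b}" by auto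
  then show ?thesis using w1 by (simp add: omega1_type_def)
qed

text \<open>A countable dense part \<open>D\<close> handles the trace of \<open>A\<close> on C. For
  an added point \<open>a\<close>, a countable initial segment \<open>Z\<close> is closed under
  choosing points of \<open>A\<close> that agree with \<open>a\<close> on finitely many
  generators.\<close>

lemma countable_tight: "countable_tightness point_top"
  unfolding countable_tightness_def
proof (intro allI impI, elim conjE)
  fix A :: "(cpt + 'w) set" and x
  assume x: "x \<in> point_top closure_of A"
  obtain D where D: "D \<subseteq> Inl -` A" "countable D"
    "\<And>S c. open S \<Longrightarrow> c \<in> Inl -` A \<Longrightarrow> c \<in> S \<Longrightarrow> \<exists>d\<in>D. d \<in> S"
    using countable_dense_subset_cpt[of "Inl -` A"] by metis
  show "\<exists>B\<subseteq>A. countable B \<and> x \<in> point_top closure_of B"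
  proof (cases x)
    case (Inl c)
    have "\<exists>y\<in>Inl ` D. y \<in> T" if T: "Inl c \<in> T" "openin point_top T" for T
    proof -
      have "open (Inl -` T)" using T(2) by (simp add: openin_point_top)
      then have "openin point_top (Inl ` (Inl -` T))" by (rule openin_Inl)
      moreover have "Inl c \<in> Inl ` (Inl -` T)" using T(1) by simp
      ultimately obtain y where "y \<in> A" "y \<in> Inl ` (Inl -` T)"
        using x[unfolded in_closure_of, THEN conjunct2, rule_format, of "Inl ` (Inl -` T)"] Inl by auto
      then obtain d where "d \<in> Inl -` A" "d \<in> Inl -` T" by auto
      then show ?thesis using D(3)[OF \<open>open (Inl -` T)\<close>] by auto
    qed
    then have "x \<in> point_top closure_of (Inl ` D)" using Inl by (auto simp: in_closure_of)
    then show ?thesis using D(1,2) by (intro exI[of _ "Inl ` D"]) auto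
  next
    case (Inr a)
    define s where "s F = (SOME d. Inr d \<in> A \<and> (\<forall>i\<in>F. m d i = m a i))" for F
    have s: "Inr (s F) \<in> A \<and> (\<forall>i\<in>F. m (s F) i = m a i)"
      if "Inr d \<in> A" "\<forall>i\<in>F. m d i = m a i" for d F
      unfolding s_def by (rule someI[of _ d]) (use that in blast)
    define J :: "'w set \<Rightarrow> (nat + 'w) set" where "J Z = range Inl \<union> Inr ` Z" for Z
    have "\<exists>b'. \<forall>z\<in>insert b (s ` {F. finite F \<and> F \<subseteq> J {..b}}). z \<le> b'" for b
      by (intro bounded_countable countable_insert countable_image countable_Collect_finite_subset)
         (auto simp: J_def countable_atMost)
    \<comment> \<open>Only countably many finite sets of indices up to \<open>b\<close> exist, so
      their chosen points have a common bound. Iterating \<open>nx\<close> from \<open>a\<close>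
      closes off in countably many steps.\<close>
    then obtain nx where nx: "\<And>b. b \<le> nx b" "\<And>b F. finite F \<Longrightarrow> F \<subseteq> J {..b} \<Longrightarrow> s F \<le> nx b"
      by (metis (mono_tags, lifting) image_eqI insertCI mem_Collect_eq)
    define b where "b n = (nx ^^ n) a" for n
    have "incseq b" by (rule incseq_SucI) (simp add: b_def nx)
    define Z where "Z = (\<Union>n. {..b n})"
    have Z: "a \<in> Z" "countable Z" "\<And>y z. z \<in> Z \<Longrightarrow> y \<le> z \<Longrightarrow> y \<in> Z"
      using countable_atMost by (auto simp: Z_def b_def intro: exI[of _ 0] order_trans)
    have sZ: "s F \<in> Z" if F: "finite F" "F \<subseteq> J Z" for F
    proof -
      have "\<exists>n. F \<subseteq> J {..b n}" using F
      proof (induction F rule: finite_induct)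
        case (insert i F)
        then obtain n where n: "F \<subseteq> J {..b n}" by auto
        obtain k where k: "i \<in> J {..b k}" using insert.prems by (auto simp: J_def Z_def)
        have "J {..b n} \<subseteq> J {..b (max n k)}" "J {..b k} \<subseteq> J {..b (max n k)}"
          using monoD[OF \<open>incseq b\<close>, of n "max n k"] monoD[OF \<open>incseq b\<close>, of k "max n k"]
          by (auto simp: J_def)
        then show ?case using n k by blast
      qed simp
      then obtain n where "F \<subseteq> J {..b n}" by blast
      then have "s F \<le> b (Suc n)" using nx(2)[OF F(1)] by (simp add: b_def)
      then show ?thesis by (auto simp: Z_def)
    qed
    define B where "B = Inl ` D \<union> Inr ` (Z \<inter> Inr -` A)"
    have "\<exists>y\<in>B. y \<in> nbhd a F M" if F: "finite F" "finite M" for F M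
    proof -
      obtain y where y: "y \<in> A" "y \<in> nbhd a F M"
        using closure_nbhdD[of a A, OF _ F] x Inr by blast
      show ?thesis
      proof (cases y)
        case (Inl c)
        then have "\<exists>d\<in>D. d \<in> Inl -` nbhd a F M"
          using y clop_Inl_nbhd[OF F(1)] by (intro D(3)[of _ c]) (auto simp: clop_def)
        then show ?thesis by (auto simp: B_def)
      next
        case (Inr d)
        define F' where "F' = F \<inter> J Z"
        have "Inr d \<in> A" "\<forall>i\<in>F'. m d i = m a i" using y Inr by (auto simp: F'_def Inr_nbhd)
        then have sF: "Inr (s F') \<in> A" "\<forall>i\<in>F'. m (s F') i = m a i" using s by blast+
        have sFZ: "s F' \<in> Z" by (rule sZ) (use F in \<open>auto simp: F'_def\<close>)
        \<comment> \<open>An index outside the initial segment \<open>Z\<close> exceeds all points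
          of \<open>Z\<close>, so by \<open>m_le\<close> neither \<open>a\<close> nor
          \<open>s F'\<close> belongs to that generator.\<close>
        have "m (s F') i = m a i" if "i \<in> F" "i \<notin> J Z" for i
        proof -
          obtain z where z: "i = Inr z" "z \<notin> Z" using \<open>i \<notin> J Z\<close> by (cases i) (auto simp: J_def)
          then have "\<not> m c i" if "c \<in> Z" for c using m_le Z(3) that by blast
          then show ?thesis using Z(1) sFZ by blast
        qed
        then have "Inr (s F') \<in> nbhd a F M" using sF(2) by (auto simp: Inr_nbhd F'_def)
        then show ?thesis using sF(1) sFZ by (auto simp: B_def)
      qed
    qed
    then have "x \<in> point_top closure_of B" using closure_nbhdI[of B a] Inr by blast
    moreover have "B \<subseteq> A" "countable B" using D(1,2) Z(2) by (auto simp: B_def)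
    ultimately show ?thesis by blast
  qed
qed

text \<open>The closed set \<open>point_ext (Inr x)\<close> contains the copy of \<open>g\<close>
  but no added point below \<open>x\<close>, so a generator indexed beyond \<open>a\<close> excludes
  \<open>a\<close>.\<close>

lemma closure_avoids:
  assumes "\<And>a. \<exists>x>a. g \<subseteq> t (Inr x)"
  shows "point_top closure_of (Inl ` g) \<inter> range Inr = {}"
proof -
  have "Inr a \<notin> point_top closure_of (Inl ` g)" for a
  proof -
    obtain x where x: "a < x" "g \<subseteq> t (Inr x)" using assms by blast
    then have "point_top closure_of (Inl ` g) \<subseteq> point_ext (Inr x)"
      by (intro closure_of_minimal closedin_ext) (auto simp: point_ext_def)
    moreover have "Inr a \<notin> point_ext (Inr x)" using x(1) m_le[of a x] by (auto simp: point_ext_def)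
    ultimately show ?thesis by blast
  qed
  then show ?thesis by blast
qed

lemma closure_meets:
  assumes "\<forall>F M. finite F \<longrightarrow> finite M \<longrightarrow> (\<exists>c\<in>A \<inter> cell (m a) t F. fst c \<notin> M)"
  shows "Inr a \<in> point_top closure_of (Inl ` A)"
proof (rule closure_nbhdI)
  fix F :: "(nat + 'w) set" and M :: "nat set" assume "finite F" "finite M"
  then obtain c where "c \<in> A \<inter> cell (m a) t F" "fst c \<notin> M" using assms by blast
  then show "\<exists>y\<in>Inl ` A. y \<in> nbhd a F M" by (intro bexI[of _ "Inl c"]) (auto simp: nbhd_def)
qed

end

section \<open>Partial functions and their ranges\<close>

lemma Cn_eq: "Cn n = fst -` {n}"
  by (auto simp: Cn_def)

lemma Efam_fst:
  assumes "e \<in> Efam" "n \<in> dom e" "c \<in> the (e n)"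
  shows "fst c = n"
proof -
  have "the (e n) \<subseteq> Cn n" using assms(1,2) unfolding Efam_def by blast
  then show ?thesis using assms(3) by (auto simp: Cn_eq)
qed

lemma mem_Rng: "e \<in> Efam \<Longrightarrow> c \<in> Rng e \<longleftrightarrow> fst c \<in> dom e \<and> c \<in> the (e (fst c))"
  unfolding Rng_def using Efam_fst by blast

lemma fst_Rng:
  assumes e: "e \<in> Efam"
  shows "fst ` Rng e = dom e"
proof (intro equalityI subsetI)
  fix n assume n: "n \<in> dom e"
  then obtain c where "c \<in> the (e n)" using e unfolding Efam_def by blast
  then show "n \<in> fst ` Rng e"
    using Efam_fst[OF e n] n unfolding Rng_def by (metis UN_I imageI)
qed (use mem_Rng[OF e] in blast)

lemma clop_Rng:
  assumes u: "u \<in> Ofam"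
  shows "clop (Rng u)"
proof (rule clop_slices)
  fix n
  have uE: "u \<in> Efam" using u by (simp add: Ofam_def)
  have Cn: "open (Cn n)" "closed (Cn n)" using clop_fst_vimage[of "{n}"] by (simp_all add: Cn_eq clop_def)
  show "clop (Rng u \<inter> fst -` {n})"
  proof (cases "n \<in> dom u")
    case True
    then have "c \<in> Rng u \<inter> fst -` {n} \<longleftrightarrow> c \<in> the (u n)" for c
      using mem_Rng[OF uE, of c] Efam_fst[OF uE True, of c] by auto
    then have "Rng u \<inter> fst -` {n} = the (u n)" by blast
    moreover have "clop (the (u n))"
      using u True Cn openin_open_trans closedin_closed_trans
      unfolding Ofam_def eps_top_eq_euclidean clop_def by blast
    ultimately show ?thesis by simp
  next
    case False
    then have "Rng u \<inter> fst -` {n} = {}" using mem_Rng[OF uE] by blast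
    then show ?thesis by (simp add: clop_def)
  qed
qed

text \<open>An inverse of \<open>Rng\<close>: empty slices are left out of the domain because
  members of \<open>Efam\<close> have nonempty values.\<close>

definition fun_of :: "cpt set \<Rightarrow> efun" where
  "fun_of T = (\<lambda>n. if n \<in> fst ` T then Some (T \<inter> Cn n) else None)"

lemma dom_fun_of: "dom (fun_of T) = fst ` T"
  by (auto simp: fun_of_def dom_def)

lemma fun_of_apply: "n \<in> fst ` T \<Longrightarrow> the (fun_of T n) = T \<inter> Cn n"
  by (simp add: fun_of_def)

lemma Rng_fun_of: "Rng (fun_of T) = T"
proof -
  have "Rng (fun_of T) = (\<Union>n\<in>fst ` T. T \<inter> Cn n)"
    unfolding Rng_def dom_fun_of by (simp add: fun_of_apply del: UN_simps)
  then show ?thesis by (auto simp: Cn_eq)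
qed

lemma fun_of_Ofam:
  assumes "clop T" "infinite (fst ` T)"
  shows "fun_of T \<in> Ofam"
proof -
  have "fun_of T \<in> Efam"
    using assms(2) unfolding Efam_def by (auto simp: dom_fun_of fun_of_apply Cn_eq)
  moreover have "openin (top_of_set (Cn n)) (T \<inter> Cn n)" "closedin (top_of_set (Cn n)) (T \<inter> Cn n)" for n
    using assms(1) openin_open_Int[of T "Cn n"] closedin_closed_Int[of T "Cn n"]
    by (simp_all add: clop_def Int_commute)
  ultimately show ?thesis
    unfolding Ofam_def eps_top_eq_euclidean by (simp add: dom_fun_of fun_of_apply)
qed

lemma sqsub_Rng: "sqsub f g \<Longrightarrow> Rng f \<subseteq> Rng g"
  by (force simp: sqsub_def Rng_def)

lemma sqsub_star_almost_sub:
  assumes "sqsub_star f (fun_of T)" "f \<in> Efam"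
  shows "almost_sub (Rng f) T"
proof -
  have "fst ` (Rng f - T) \<subseteq> {n \<in> dom f. n \<notin> dom (fun_of T) \<or> \<not> the (f n) \<subseteq> the (fun_of T n)}"
  proof
    fix n assume "n \<in> fst ` (Rng f - T)"
    then obtain c where c: "n = fst c" "c \<in> Rng f" "c \<notin> T" by blast
    then have "n \<in> dom f" "c \<in> the (f n)" using mem_Rng[OF assms(2), of c] by simp_all
    moreover have "c \<notin> the (fun_of T n)" if "n \<in> dom (fun_of T)"
      using that c(3) by (simp add: dom_fun_of fun_of_apply)
    ultimately show "n \<in> {n \<in> dom f. n \<notin> dom (fun_of T) \<or> \<not> the (f n) \<subseteq> the (fun_of T n)}" by blast
  qed
  then show ?thesis using assms(1) unfolding sqsub_star_def almost_sub_def by (meson finite_subset)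
qed

lemma eperp_almost_sub:
  assumes "eperp f (fun_of T)" "f \<in> Efam"
  shows "almost_sub (Rng f) (- T)"
proof -
  have "fst ` (Rng f - - T) \<subseteq> {n \<in> dom f \<inter> dom (fun_of T). the (f n) \<inter> the (fun_of T n) \<noteq> {}}"
  proof
    fix n assume "n \<in> fst ` (Rng f - - T)"
    then obtain c where c: "n = fst c" "c \<in> Rng f" "c \<in> T" by blast
    then have "n \<in> dom f" "c \<in> the (f n)" using mem_Rng[OF assms(2), of c] by simp_all
    moreover have "n \<in> fst ` T" using c by blast
    then have "n \<in> dom (fun_of T)" "c \<in> the (fun_of T n)"
      using c by (simp_all add: dom_fun_of fun_of_apply Cn_eq)
    ultimately show "n \<in> {n \<in> dom f \<inter> dom (fun_of T). the (f n) \<inter> the (fun_of T n) \<noteq> {}}" by blast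
  qed
  then show ?thesis using assms(1) unfolding eperp_def almost_sub_def by (meson finite_subset)
qed

lemma Rng_eminus:
  assumes "h \<in> Efam" "u \<in> Efam"
  shows "Rng (eminus h u) = Rng h - Rng u"
proof -
  have "c \<in> Rng (eminus h u) \<longleftrightarrow> c \<in> Rng h \<and> c \<notin> Rng u" for c
  proof -
    have "c \<in> Rng (eminus h u) \<longleftrightarrow> (\<exists>n. n \<in> dom h \<and> c \<in> the (h n) \<and> (n \<in> dom u \<longrightarrow> c \<notin> the (u n)))"
      by (auto simp: Rng_def eminus_def dom_def split: if_splits)
    also have "\<dots> \<longleftrightarrow> c \<in> Rng h \<and> c \<notin> Rng u"
      unfolding mem_Rng[OF assms(1)] mem_Rng[OF assms(2)]
      using Efam_fst[OF assms(1)] by blast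
    finally show ?thesis .
  qed
  then show ?thesis by blast
qed

lemma large_family_Rng:
  assumes GE: "G \<subseteq> Efam" and HE: "H \<subseteq> Efam"
    and Hdense: "dense_fam H" and Hshr: "shrinkable H" and Hlarge: "large G H"
  shows "large_family (Rng ` H) (Rng ` G)"
proof
  fix A assume "A \<in> Rng ` H"
  then obtain h where "h \<in> Efam" "A = Rng h" using HE by blast
  then show "infinite (fst ` A)" by (simp add: fst_Rng Efam_def)
next
  fix T :: "cpt set" assume "clop T" "infinite (fst ` T)"
  then obtain h where "h \<in> H" "sqsub h (fun_of T)"
    using Hdense fun_of_Ofam unfolding dense_fam_def by blast
  then show "\<exists>A\<in>Rng ` H. A \<subseteq> T" 
    using sqsub_Rng[of h "fun_of T"] by (auto simp: Rng_fun_of)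
next
  fix A and \<T> :: "cpt set set" assume A: "A \<in> Rng ` H" and T: "countable \<T>" "\<And>T. T \<in> \<T> \<Longrightarrow> clop T"
  obtain h where h: "h \<in> H" "A = Rng h" using A by blast
  \<comment> \<open>A clopen set meeting only finitely many levels yields no member of
    \<open>Ofam\<close>; its complement almost contains every set, so it is decided at once.\<close>
  define \<O> where "\<O> = fun_of ` {T \<in> \<T>. infinite (fst ` T)}"
  have "\<O> \<subseteq> Ofam" "countable \<O>" using T fun_of_Ofam by (auto simp: \<O>_def)
  then obtain h' where h': "h' \<in> H" "sqsub h' h" "\<forall>u\<in>\<O>. sqsub_star h' u \<or> eperp h' u"
    using Hshr h(1) unfolding shrinkable_def by blast
  have "almost_sub (Rng h') T \<or> almost_sub (Rng h') (- T)" if "T \<in> \<T>" for T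
  proof (cases "finite (fst ` T)")
    case True
    then have "almost_sub (Rng h') (- T)"
      unfolding almost_sub_def by (rule rev_finite_subset) blast
    then show ?thesis ..
  next
    case False
    then have "fun_of T \<in> \<O>" using that by (simp add: \<O>_def)
    then have "sqsub_star h' (fun_of T) \<or> eperp h' (fun_of T)" using h'(3) by blast
    moreover have "h' \<in> Efam" using h'(1) HE by blast
    ultimately show ?thesis using sqsub_star_almost_sub eperp_almost_sub by metis
  qed
  then show "\<exists>B\<in>Rng ` H. B \<subseteq> A \<and> (\<forall>T\<in>\<T>. almost_sub B T \<or> almost_sub B (- T))"

    using h'(1) sqsub_Rng[OF h'(2)] h(2) by blast
next
  fix g and \<A> :: "cpt set set" assume g: "g \<in> Rng ` G" and \<A>: "\<A> \<subseteq> Rng ` H" "countable \<A>"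
  obtain e where e: "e \<in> G" "g = Rng e" using g by blast
  obtain \<H> where \<H>: "\<H> \<subseteq> H" "countable \<H>" "\<A> = Rng ` \<H>"
    using countable_subset_image[of \<A> Rng H] \<A> by auto
  obtain u where u: "u \<in> Ofam" "sqsub e u" "\<forall>h\<in>\<H>. eminus h u \<in> H"
    using Hlarge e(1) \<H>(1,2) unfolding large_def by blast
  have "A - Rng u \<in> Rng ` H" if "A \<in> \<A>" for A
  proof -
    obtain h where h: "h \<in> \<H>" "A = Rng h" using \<open>A \<in> \<A>\<close> \<H>(3) by blast
    then have "Rng (eminus h u) = A - Rng u"
      using HE \<H>(1) u(1) by (auto simp: Ofam_def intro!: Rng_eminus)
    then show ?thesis using u(3) h(1) by (metis imageI)
  qed
  then show "\<exists>T. clop T \<and> g \<subseteq> T \<and> (\<forall>A\<in>\<A>. A - T \<in> Rng ` H)"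
    using clop_Rng[OF u(1)] sqsub_Rng[OF u(2)] e(2) by blast
qed

theorem theorem2p6:
  fixes G H :: "efun set"
  assumes w1: "omega1_type TYPE('w::wellorder)"
    and CH: "\<exists>f :: 'w \<Rightarrow> (nat \<Rightarrow> bool). bij f"
    and GE: "G \<subseteq> Efam" and HE: "H \<subseteq> Efam"
    and Hdense: "dense_fam H" and Hshr: "shrinkable H" and Hlarge: "large G H"
  shows "\<exists>\<tau> :: (cpt + 'w) topology.
     topspace \<tau> = UNIV \<and> \<tau> dim_le 0 \<and> Hausdorff_space \<tau> \<and>
     countable_tightness \<tau> \<and>
     (\<forall>a::'w. closedin (subtopology \<tau> (range Inr)) (Inr ` {b. b < a})) \<and>
     openin \<tau> (range Inl) \<and> \<tau> closure_of (range Inl) = UNIV \<and>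
     homeomorphic_map eps_top (subtopology \<tau> (range Inl)) Inl \<and>
     (\<forall>g\<in>G. \<tau> closure_of (Inl ` Rng g) \<inter> range Inr = {}) \<and>
     (\<forall>h\<in>H. \<tau> closure_of (Inl ` Rng h) \<inter> range Inr \<noteq> {})"
proof -
  interpret large_family "Rng ` H" "Rng ` G"
    using GE HE Hdense Hshr Hlarge by (rule large_family_Rng)
  obtain t :: "nat + 'w \<Rightarrow> cpt set" and m :: "'w \<Rightarrow> nat + 'w \<Rightarrow> bool"
    where tm: "\<And>i. clop (t i)" "\<And>a x. m a (Inr x) \<Longrightarrow> x \<le> a" "\<And>a. m a (Inr a)"
      "\<And>a F M. finite F \<Longrightarrow> finite M \<Longrightarrow> \<exists>c\<in>cell (m a) t F. fst c \<notin> M"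
    and G: "\<And>A a. A \<in> Rng ` G \<Longrightarrow> \<exists>x>a. A \<subseteq> t (Inr x)"
    and H: "\<And>A. A \<in> Rng ` H \<Longrightarrow>
      \<exists>a. \<forall>F M. finite F \<longrightarrow> finite M \<longrightarrow> (\<exists>c\<in>A \<inter> cell (m a) t F. fst c \<notin> M)"
    using point_data_exist[OF w1 CH] by blast
  interpret point_data t m
    using w1 tm by unfold_locales
  show ?thesis
  proof (intro exI[of _ point_top] conjI allI ballI)
    show "openin point_top (range Inl)" using openin_Inl[of UNIV] by simp
    show "homeomorphic_map eps_top (subtopology point_top (range Inl)) Inl"
      unfolding eps_top_eq_euclidean by (rule homeomorphic_Inl)
    show "point_top closure_of (Inl ` Rng g) \<inter> range Inr = {}" if "g \<in> G" for g
      by (rule closure_avoids) (use G that in blast)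
    show "point_top closure_of (Inl ` Rng h) \<inter> range Inr \<noteq> {}" if "h \<in> H" for h
      using H[OF imageI[OF that]] closure_meets by blast
  qed (rule topspace_point_top zero_dimensional Hausdorff countable_tight left_separated dense_Inl)+
qed

end
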